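(* Let $X,B\in\mathbb{R}^{n\times m}$ and consider the singular value decomposition $$X=U\Sigma V^\top=\begin{pmatrix}U_1&U_2\end{pmatrix}\begin{pmatrix}\Sigma_1&0\\0&0\end{pmatrix}\begin{pmatrix}V_1&V_2\end{pmatrix}^\top,$$ where $\Sigma_1\in\mathbb{R}^{r\times r}$ has full rank. Then $$\inf_{A\in\mathcal{N}_\succeq^n}\|AX-B\|_F^2=\min_{A_{11}\in\mathcal{N}_\succeq^r}\|A_{11}\Sigma_1-U_1^\top BV_1\|_F^2+\|BV_2\|_F^2 .$$ Moreover, let $$\hat A_{11}=\operatorname*{arg\,min}_{A_{11}\in\mathcal{N}_\succeq^r}\|A_{11}\Sigma_1-U_1^\top BV_1\|_F^2=:\hat H_{11}+\hat S_{11},$$ where $\hat H_{11}$ and $\hat S_{11}$ are, respectively, the symmetric and the skew-symmetric part of $\hat A_{11}$. Then any solution of the problem $\inf_{A\in\mathcal{N}_\succeq^n}\|AX-B\|_F^2$ is of the form $$A_\star=U\begin{pmatrix}\hat A_{11}&M^\top\\Z&N+G\end{pmatrix}U^\top=U_1\hat A_{11}U_1^\top+U_2ZU_1^\top+U_1M^\top U_2^\top+U_2(N+G)U_2^\top,$$ where $Z=U_2^\top BV_1\Sigma_1^{-1}\in\mathbb{R}^{(n-r)\times r}$, $M\in\mathbb{R}^{(n-r)\times r}$, $G\in\mathbb{R}^{(n-r)\times(n-r)}$ is skew-symmetric, $N\in\mathbb{R}^{(n-r)\times(n-r)}$ is symmetric, and they fulfil the conditions $$\ker(\hat H_{11})\subseteq\ker(Z+M),\qquad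 N\succeq\tfrac14(Z+M)\hat H_{11}^\dagger(Z+M)^\top,$$ so that $A_\star\in\mathcal{N}_\succeq^n$.
   Context: $\|\cdot\|_F$ is the Frobenius norm. For symmetric matrices, $P\succeq Q$ means that $P-Q$ is positive semidefinite. $\mathcal{N}_\succeq^n=\{A\in\mathbb{R}^{n\times n}: A+A^\top\succeq0\}$ is the set of matrices whose symmetric part is positive semidefinite. $P^\dagger$ denotes the Moore–Penrose pseudo-inverse. In the singular value decomposition, $U\in\mathbb{R}^{n\times n}$ and $V\in\mathbb{R}^{m\times m}$ are orthogonal, $U_1\in\mathbb{R}^{n\times r}$, $U_2\in\mathbb{R}^{n\times(n-r)}$, $V_1\in\mathbb{R}^{m\times r}$, $V_2\in\mathbb{R}^{m\times(m-r)}$, and $\Sigma_1$ is diagonal with positive diagonal entries, so $r=\operatorname{rank}(X)$. Because $\Sigma_1$ is invertible, the reduced problem $\min_{A_{11}\in\mathcal{N}_\succeq^r}\|A_{11}\Sigma_1-U_1^\top BV_1\|_F^2$ has a unique minimizer, denoted $\hat A_{11}$. *)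

theory Defs
  imports
    Complex_Main
    "Jordan_Normal_Form.Gauss_Jordan_Elimination"
    "Jordan_Normal_Form.Matrix_Kernel"
begin

definition frob_norm :: "real mat \<Rightarrow> real" where
  "frob_norm A = sqrt (\<Sum>i<dim_row A. \<Sum>j<dim_col A. (A $$ (i,j))\<^sup>2)"

definition psd_mat :: "nat \<Rightarrow> real mat \<Rightarrow> bool" where
  "psd_mat n P \<longleftrightarrow> P \<in> carrier_mat n n \<and> P\<^sup>T = P \<and>
     (\<forall>v \<in> carrier_vec n. 0 \<le> v \<bullet> (P *\<^sub>v v))"

definition psd_ge :: "nat \<Rightarrow> real mat \<Rightarrow> real mat \<Rightarrow> bool" where
  "psd_ge n P Q \<longleftrightarrow> psd_mat n (P - Q)"

definition psd_sym_part_mats :: "nat \<Rightarrow> real mat set" where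
  "psd_sym_part_mats n = {A \<in> carrier_mat n n. psd_mat n (A + A\<^sup>T)}"

definition sym_part :: "real mat \<Rightarrow> real mat" where
  "sym_part A = (1/2) \<cdot>\<^sub>m (A + A\<^sup>T)"

definition skew_part :: "real mat \<Rightarrow> real mat" where
  "skew_part A = (1/2) \<cdot>\<^sub>m (A - A\<^sup>T)"

(* The constant orthogonal_mat of the library only asks for orthogonal nonzero
   columns; here the columns are orthonormal. *)
definition orthonormal_mat :: "nat \<Rightarrow> real mat \<Rightarrow> bool" where
  "orthonormal_mat n U \<longleftrightarrow> U \<in> carrier_mat n n \<and> U\<^sup>T * U = 1\<^sub>m n \<and> U * U\<^sup>T = 1\<^sub>m n"

definition append_cols :: "real mat \<Rightarrow> real mat \<Rightarrow> real mat" where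
  "append_cols A B = four_block_mat A B (0\<^sub>m 0 (dim_col A)) (0\<^sub>m 0 (dim_col B))"

(* The four Penrose conditions; they determine P uniquely. *)
definition is_moore_penrose :: "real mat \<Rightarrow> real mat \<Rightarrow> bool" where
  "is_moore_penrose A P \<longleftrightarrow> P \<in> carrier_mat (dim_col A) (dim_row A) \<and>
     A * P * A = A \<and> P * A * P = P \<and> (A * P)\<^sup>T = A * P \<and> (P * A)\<^sup>T = P * A"

definition pinv :: "real mat \<Rightarrow> real mat" where
  "pinv A = (THE P. is_moore_penrose A P)"

end

theory Submission
  imports Defs
begin

text \<open>Put \<open>T = U\<^sup>T A U\<close>. By orthogonal invariance of the Frobenius norm the residual splits into
  \<open>\<parallel>A\<^sub>1\<^sub>1 \<Sigma>\<^sub>1 - U\<^sub>1\<^sup>T B V\<^sub>1\<parallel>\<^sup>2 + \<parallel>A\<^sub>2\<^sub>1 \<Sigma>\<^sub>1 - U\<^sub>2\<^sup>T B V\<^sub>1\<parallel>\<^sup>2 + \<parallel>B V\<^sub>2\<parallel>\<^sup>2\<close>, where \<open>A\<^sub>1\<^sub>1\<close> ranges over matrices with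
  positive semidefinite symmetric part. Choosing \<open>A\<^sub>2\<^sub>1 = Z\<close>, \<open>A\<^sub>1\<^sub>2 = - Z\<^sup>T\<close> and \<open>A\<^sub>2\<^sub>2 = 0\<close> removes the
  coupling between the blocks, so the lower bound is attained and every solution has \<open>A\<^sub>1\<^sub>1\<close> equal to the
  unique minimizer and \<open>A\<^sub>2\<^sub>1 = Z\<close>; the remaining freedom is described by the generalized Schur
  complement.\<close>

subsection \<open>The Moore--Penrose inverse of a symmetric matrix\<close>

text \<open>The products with \<open>A\<close> agree first: A P = (A Q)(A P) is a product of
  symmetric matrices, and transposing it gives A P A Q = A Q; similarly P A = Q A. Then P = P A P =
  Q A P = Q A Q = Q.\<close>

lemma moore_penrose_unique:
  assumes P: "is_moore_penrose A P" and Q: "is_moore_penrose A Q"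
  shows "P = Q"
proof -
  define n m where "n = dim_row A" and "m = dim_col A"
  have A: "A \<in> carrier_mat n m" by (simp add: n_def m_def)
  have c: "P \<in> carrier_mat m n" "Q \<in> carrier_mat m n"
    using P Q by (auto simp: is_moore_penrose_def n_def m_def)
  have p: "A * P * A = A" "P * A * P = P" "(A * P)\<^sup>T = A * P" "(P * A)\<^sup>T = P * A"
    and q: "A * Q * A = A" "Q * A * Q = Q" "(A * Q)\<^sup>T = A * Q" "(Q * A)\<^sup>T = Q * A"
    using P Q by (auto simp: is_moore_penrose_def)
  have "A * P = (A * Q * A) * P" by (simp add: q)
  also have "\<dots> = A * Q * (A * P)"
    using A c by (intro assoc_mult_mat[of "A * Q" n n A m P n]) auto
  also have "\<dots> = (A * Q)\<^sup>T * (A * P)\<^sup>T" by (simp add: p q)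
  also have "\<dots> = (A * P * (A * Q))\<^sup>T"
    using A c by (simp add: transpose_mult[of _ n n _ n])
  also have "A * P * (A * Q) = A * P * A * Q"
    using A c by (intro assoc_mult_mat[of "A * P" n n A m Q n, symmetric]) auto
  also have "\<dots>\<^sup>T = A * Q" by (simp add: p q)
  finally have AP: "A * P = A * Q" .
  have "Q * A = Q * (A * P * A)" by (simp add: p)
  also have "\<dots> = Q * A * (P * A)"
    using A c by (simp add: assoc_mult_mat[of _ m n _ m _ m] assoc_mult_mat[of _ n m _ n _ m])
  also have "\<dots> = (Q * A)\<^sup>T * (P * A)\<^sup>T" by (simp add: p q)
  also have "\<dots> = (P * A * (Q * A))\<^sup>T"
    using A c by (simp add: transpose_mult[of _ m m _ m])
  also have "P * A * (Q * A) = P * (A * Q * A)"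
    using A c by (simp add: assoc_mult_mat[of _ m n _ m _ m] assoc_mult_mat[of _ n m _ n _ m])
  also have "(P * (A * Q * A))\<^sup>T = P * A" by (simp add: p q)
  finally have PA: "Q * A = P * A" .
  have "P = P * A * P" by (simp add: p)
  also have "\<dots> = Q * (A * P)"
    using A c by (simp add: PA[symmetric] assoc_mult_mat[of _ m n _ m _ n])
  also have "\<dots> = Q * A * Q" unfolding AP
    using A c by (simp add: assoc_mult_mat[of _ m n _ m _ n])
  also have "\<dots> = Q" by (rule q)
  finally show ?thesis .
qed

lemma pinv_eqI: "is_moore_penrose A P \<Longrightarrow> pinv A = P"
  unfolding pinv_def by (rule the_equality) (auto intro: moore_penrose_unique)

text \<open>Pivot columns of an echelon form are unit vectors. Selecting them by \<open>G\<close>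
  makes \<open>R * G\<close> the 0/1 diagonal projection onto the nonzero rows, which fixes
  \<open>R\<close>.\<close>

lemma generalized_inverse_pivot:
  assumes R: "(R :: 'a::field mat) \<in> carrier_mat nr nc" and f: "pivot_fun R f nc"
  shows "\<exists>G \<in> carrier_mat nc nr. R * G * R = R"
proof -
  have d: "dim_row R = nr" using R by simp
  note p = pivot_funD[OF d f]
  \<comment> \<open>Column i of \<open>G\<close> is the unit vector at the pivot position
    \<open>f i\<close>. For a zero row \<open>f i = nc\<close> is out of range, so that column is
    zero.\<close>
  define G :: "'a mat" where "G = mat nc nr (\<lambda>(j,i). if j = f i then 1 else 0)"
  have G: "G \<in> carrier_mat nc nr" by (simp add: G_def)
  have RG: "(R * G) $$ (l,i) = (if f i < nc \<and> l = i then 1 else 0)" if "l < nr" "i < nr" for l i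
  proof -
    have "(R * G) $$ (l,i) = (\<Sum>j = 0..<nc. R $$ (l,j) * (if j = f i then 1 else 0))"
      using R that by (simp add: G_def scalar_prod_def)
    also have "\<dots> = (\<Sum>j = 0..<nc. if j = f i then R $$ (l,j) else 0)"
      by (intro sum.cong) auto
    also have "\<dots> = (if f i < nc then R $$ (l, f i) else 0)" by simp
    also have "\<dots> = (if f i < nc \<and> l = i then 1 else 0)"
      using p(4,5)[OF that(2)] that by auto
    finally show ?thesis .
  qed
  have "R * G * R = R"
  proof (rule eq_matI)
    fix l k assume "l < dim_row R" "k < dim_col R"
    then have lk: "l < nr" "k < nc" using R by auto
    have "(R * G * R) $$ (l,k) = (\<Sum>i = 0..<nr. (R * G) $$ (l,i) * R $$ (i,k))"
      using R G lk by (simp add: scalar_prod_def del: assoc_mult_mat)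
    also have "\<dots> = (\<Sum>i = 0..<nr. if i = l then (if f l < nc then R $$ (l,k) else 0) else 0)"
      by (intro sum.cong) (auto simp: RG lk)
    also have "\<dots> = (if f l < nc then R $$ (l,k) else 0)" using lk by simp
    also have "\<dots> = R $$ (l,k)"
      using p(1,2)[OF lk(1)] lk by (auto simp: le_less)
    finally show "(R * G * R) $$ (l,k) = R $$ (l,k)" .
  qed (use R G in auto)
  with G show ?thesis by blast
qed

text \<open>Gauss-Jordan elimination gives R = P A with Q P = 1. A generalized inverse G of R pulls
  back to G P, since A G P A = Q R G R = Q R = A.\<close>

lemma generalized_inverse_exists:
  assumes A: "(A :: 'a::field mat) \<in> carrier_mat nr nc"
  shows "\<exists>G \<in> carrier_mat nc nr. A * G * A = A"
proof -
  define R where "R = gauss_jordan_single A"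
  note gj = gauss_jordan_single[OF A R_def[symmetric]]
  obtain f where f: "pivot_fun R f nc"
    using gj(2,3) unfolding row_echelon_form_def by auto
  obtain G where G: "G \<in> carrier_mat nc nr" "R * G * R = R"
    using generalized_inverse_pivot[OF gj(2) f] by blast
  obtain P Q where PQ: "R = P * A" "P \<in> carrier_mat nr nr" "Q \<in> carrier_mat nr nr" "Q * P = 1\<^sub>m nr"
    using gj(4) by blast
  have QR: "Q * R = A"
    using PQ A by (simp add: assoc_mult_mat[of Q nr nr P nr A nc, symmetric])
  have "A * (G * P) * A = A * G * R"
    unfolding PQ(1) using A G(1) PQ(2-) by (simp add: assoc_mult_mat[of A nr nc "G * P" nr A nc]
      assoc_mult_mat[of G nc nr P nr A nc] assoc_mult_mat[of A nr nc G nr "P * A" nc])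
  also have "\<dots> = Q * R * G * R" by (simp add: QR)
  also have "\<dots> = Q * (R * G * R)"
    using gj(2) G PQ(3) by (simp add: assoc_mult_mat[of Q nr nr R nc G nr]
      assoc_mult_mat[of Q nr nr "R * G" nr R nc])
  also have "\<dots> = A" by (simp add: G QR)
  finally show ?thesis using G PQ by (intro bexI[of _ "G * P"]) auto
qed

text \<open>The diagonal entries of the Gram matrix are the squared norms of the columns, so real
  columns must vanish. This is the cancellation principle behind the symmetric
  pseudo-inverse.\<close>

lemma mat_eq_zero_if_transpose_mult_self:
  assumes A: "(A :: real mat) \<in> carrier_mat n m" and 0: "A\<^sup>T * A = 0\<^sub>m m m"
  shows "A = 0\<^sub>m n m"
proof (rule eq_matI)
  fix i j assume "i < dim_row (0\<^sub>m n m :: real mat)" "j < dim_col (0\<^sub>m n m :: real mat)"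
  then have ij: "i < n" "j < m" by auto
  have "(A\<^sup>T * A) $$ (j,j) = (\<Sum>k = 0..<n. (A $$ (k,j))\<^sup>2)"
    using A ij by (simp add: scalar_prod_def power2_eq_square)
  then have "(\<Sum>k = 0..<n. (A $$ (k,j))\<^sup>2) = 0" using 0 ij by simp
  then show "A $$ (i,j) = 0\<^sub>m n m $$ (i,j)"
    using ij by (simp add: sum_nonneg_eq_0_iff)
qed (use A in auto)

lemma eq_if_minus_mat_eq_zero:
  fixes A B :: "'a :: group_add mat"
  assumes "A \<in> carrier_mat n m" "B \<in> carrier_mat n m" and 0: "A - B = 0\<^sub>m n m"
  shows "A = B"
proof (rule eq_matI)
  fix i j assume "i < dim_row B" "j < dim_col B"
  then have ij: "i < n" "j < m" using assms by auto
  have "(A - B) $$ (i,j) = 0" unfolding 0 using ij by simp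
  then show "A $$ (i,j) = B $$ (i,j)" using assms(1,2) ij by simp
qed (use assms in auto)

lemma half_smult_add_self:
  assumes "A \<in> carrier_mat n n"
  shows "(1/2 :: real) \<cdot>\<^sub>m (A + A) = A"
  using assms by (intro eq_matI) auto

text \<open>With a symmetric \<open>K\<close> such that \<open>H\<^sup>2 K H\<^sup>2 = H\<^sup>2\<close>, symmetry of \<open>H\<close> allows cancelling one factor
  \<open>H\<close> on either side, and then \<open>H K H K H\<close> satisfies the Penrose conditions.\<close>

lemma moore_penrose_symmetric_exists:
  assumes H: "H \<in> carrier_mat n n" and sym: "H\<^sup>T = H"
  shows "\<exists>P. is_moore_penrose H P \<and> P\<^sup>T = P"
proof -
  note a = assoc_mult_mat[of _ n n _ n _ n]
  have [simp]: "Y * W \<in> carrier_mat n n" if "Y \<in> carrier_mat n n" "W \<in> carrier_mat n n"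
    for Y W :: "real mat" using that by simp
  obtain L where L: "L \<in> carrier_mat n n" and HL: "H * H * L * (H * H) = H * H"
    using generalized_inverse_exists[of "H * H" n n] H by auto
  \<comment> \<open>Since \<open>H * H\<close> is symmetric, the transpose of \<open>L\<close> is a
    generalized inverse of it too, and so is the average, which is moreover symmetric.\<close>
  define K where "K = (1/2) \<cdot>\<^sub>m (L + L\<^sup>T)"
  have K: "K \<in> carrier_mat n n" using L by (simp add: K_def)
  have KT: "K\<^sup>T = K"
    unfolding K_def using L by (intro eq_matI) auto
  have HLT: "H * H * L\<^sup>T * (H * H) = H * H"
    using arg_cong[OF HL, of transpose_mat] H L
    by (simp add: transpose_mult[of _ n n _ n] sym a)
  have "H * H * K * (H * H) = (1/2) \<cdot>\<^sub>m (H * H * L * (H * H) + H * H * L\<^sup>T * (H * H))"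
    unfolding K_def using H L
    by (simp add: mult_smult_distrib[of _ n n _ n] mult_smult_assoc_mat[of _ n n _ n]
      mult_add_distrib_mat[of _ n n _ n] add_mult_distrib_mat[of _ n n _ _ n])
  also have "\<dots> = H * H"
    unfolding HL HLT using H by (simp add: half_smult_add_self[of _ n])
  finally have HK: "H * H * K * (H * H) = H * H" .
  \<comment> \<open>\<open>D\<close> is the defect of the desired cancellation. It satisfies H D =
    0, and its transpose ends in a factor \<open>H\<close>, so its Gram matrix vanishes.\<close>
  define D where "D = H * K * H * H - H"
  have D: "D \<in> carrier_mat n n" using H by (simp add: D_def minus_carrier_mat)
  have "H * D = H * H * K * (H * H) - H * H"
    unfolding D_def using H K by (simp add: mult_minus_distrib_mat[of _ n n _ n] a)
  then have HD: "H * D = 0\<^sub>m n n" using H by (simp add: HK)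
  have DT: "D\<^sup>T = (H * H * K - 1\<^sub>m n) * H"
    unfolding D_def using H K by (simp add: transpose_minus[of _ n n] transpose_mult[of _ n n _ n]
      sym KT a minus_mult_distrib_mat[of _ n n _ _ n])
  have "D\<^sup>T * D = (H * H * K - 1\<^sub>m n) * (H * D)"
    unfolding DT using H K D by (intro assoc_mult_mat[of _ n n _ n]) (auto intro!: minus_carrier_mat)
  also have "\<dots> = 0\<^sub>m n n"
    unfolding HD using H K by (intro right_mult_zero_mat) (auto intro!: minus_carrier_mat)
  finally have D0: "D = 0\<^sub>m n n" by (rule mat_eq_zero_if_transpose_mult_self[OF D])
  have c1: "H * K * H * H = H"
    using D0[unfolded D_def] by (rule eq_if_minus_mat_eq_zero[rotated 2]) (simp_all add: H K a)
  have c2: "H * H * K * H = H"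
    using arg_cong[OF c1, of transpose_mat] H K
    by (simp add: transpose_mult[of _ n n _ n] sym KT a)
  define P where "P = H * K * H * K * H"
  have P: "P \<in> carrier_mat n n" using H K by (simp add: P_def)
  have PT: "P\<^sup>T = P"
    unfolding P_def using H K by (simp add: transpose_mult[of _ n n _ n] sym KT a)
  \<comment> \<open>Both products of \<open>H\<close> and \<open>P\<close> collapse to the symmetric
    matrix \<open>H * K * H\<close>; the Penrose conditions follow from this.\<close>
  have "H * P = H * H * K * H * K * H" unfolding P_def using H K
    by (simp add: a)
  then have HP: "H * P = H * K * H" by (simp add: c2)
  have "P * H = H * K * (H * K * H * H)" unfolding P_def using H K by (simp add: a)
  then have PH: "P * H = H * K * H" by (simp add: c1)
  have "P * H * P = H * K * H * H * K * H * K * H"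
    unfolding PH unfolding P_def using H K by (simp add: a)
  also have "\<dots> = P" by (simp add: c1 P_def)
  finally have PHP: "P * H * P = P" .
  have T: "(H * K * H)\<^sup>T = H * K * H"
    using H K by (simp add: transpose_mult[of _ n n _ n] sym KT a)
  have "is_moore_penrose H P"
    unfolding is_moore_penrose_def using P H PHP by (simp add: HP PH T c1)
  with PT show ?thesis by blast
qed

text \<open>Existence and uniqueness together resolve the \<open>THE\<close> in \<open>pinv\<close>;
  the symmetry comes from the explicit witness.\<close>

lemma pinv_symmetric:
  assumes H: "H \<in> carrier_mat n n" "H\<^sup>T = H"
  shows "pinv H \<in> carrier_mat n n" "(pinv H)\<^sup>T = pinv H" "H * pinv H * H = H"
    "pinv H * H * pinv H = pinv H"
proof -
  obtain P where P: "is_moore_penrose H P" "P\<^sup>T = P"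
    using moore_penrose_symmetric_exists[OF H] by blast
  then have "pinv H = P" by (intro pinv_eqI)
  with P H show "pinv H \<in> carrier_mat n n" "(pinv H)\<^sup>T = pinv H" "H * pinv H * H = H"
    "pinv H * H * pinv H = pinv H"
    by (auto simp: is_moore_penrose_def)
qed

subsection \<open>Quadratic forms and the generalized Schur complement\<close>

lemma scalar_prod_transpose_mult:
  fixes A :: "'a :: comm_semiring_0 mat"
  assumes "A \<in> carrier_mat nr nc" "v \<in> carrier_vec nc" "w \<in> carrier_vec nr"
  shows "v \<bullet> (A\<^sup>T *\<^sub>v w) = w \<bullet> (A *\<^sub>v v)"
  using transpose_vec_mult_scalar[OF assms] assms
  by (simp add: comm_scalar_prod[of v nc "A\<^sup>T *\<^sub>v w"] mult_mat_vec_carrier[of _ nc nr])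

lemma scalar_prod_smult_mat_vec:
  fixes A :: "'a :: comm_ring mat"
  assumes "A \<in> carrier_mat nr nc" "v \<in> carrier_vec nc" "w \<in> carrier_vec nr"
  shows "w \<bullet> (k \<cdot>\<^sub>m A *\<^sub>v v) = k * (w \<bullet> (A *\<^sub>v v))"
proof -
  have "k \<cdot>\<^sub>m A *\<^sub>v v = k \<cdot>\<^sub>v (A *\<^sub>v v)"
    using assms by (intro eq_vecI) auto
  then show ?thesis using assms by (simp add: mult_mat_vec_carrier[of _ nr nc])
qed

lemma quadratic_form_add_transpose:
  assumes A: "(A :: real mat) \<in> carrier_mat n n" and v: "v \<in> carrier_vec n"
  shows "v \<bullet> ((A + A\<^sup>T) *\<^sub>v v) = 2 * (v \<bullet> (A *\<^sub>v v))"
proof -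
  have "v \<bullet> ((A + A\<^sup>T) *\<^sub>v v) = v \<bullet> (A *\<^sub>v v) + v \<bullet> (A\<^sup>T *\<^sub>v v)"
    using assms by (simp add: add_mult_distrib_mat_vec[of _ n n] scalar_prod_add_distrib[of _ n]
      mult_mat_vec_carrier[of _ n n])
  then show ?thesis using scalar_prod_transpose_mult[OF A v v] by simp
qed

text \<open>The form of A + A^T is twice that of A, so the constraint can be tested on
  \<open>A\<close> itself. Later arguments use the cone in this form.\<close>

lemma psd_sym_part_mats_iff:
  "A \<in> psd_sym_part_mats n \<longleftrightarrow>
    A \<in> carrier_mat n n \<and> (\<forall>v \<in> carrier_vec n. 0 \<le> v \<bullet> (A *\<^sub>v v))"
proof (cases "A \<in> carrier_mat n n")
  case True
  then have "(A + A\<^sup>T)\<^sup>T = A + A\<^sup>T" by (intro eq_matI) auto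
  with True show ?thesis
    by (auto simp: psd_sym_part_mats_def psd_mat_def quadratic_form_add_transpose)
qed (simp add: psd_sym_part_mats_def)

lemma quadratic_form_sym_part:
  assumes A: "A \<in> carrier_mat n n" and v: "v \<in> carrier_vec n"
  shows "v \<bullet> (sym_part A *\<^sub>v v) = v \<bullet> (A *\<^sub>v v)"
  unfolding sym_part_def using assms
  by (simp add: scalar_prod_smult_mat_vec[of _ n n] quadratic_form_add_transpose)

lemma sym_part_carrier: "A \<in> carrier_mat n n \<Longrightarrow> sym_part A \<in> carrier_mat n n"
  by (simp add: sym_part_def)

lemma skew_part_carrier: "A \<in> carrier_mat n n \<Longrightarrow> skew_part A \<in> carrier_mat n n"
  by (simp add: skew_part_def minus_carrier_mat)

lemma sym_part_symmetric: "A \<in> carrier_mat n n \<Longrightarrow> (sym_part A)\<^sup>T = sym_part A"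
  unfolding sym_part_def by (intro eq_matI) auto

lemma skew_part_skew: "A \<in> carrier_mat n n \<Longrightarrow> (skew_part A)\<^sup>T = - skew_part A"
  unfolding skew_part_def by (intro eq_matI) (auto simp: field_simps)

lemma sym_part_add_skew_part: "A \<in> carrier_mat n n \<Longrightarrow> sym_part A + skew_part A = A"
  unfolding sym_part_def skew_part_def by (intro eq_matI) (auto simp: field_simps)

text \<open>The form of the transpose of \<open>G\<close> equals that of \<open>G\<close>, and by
  skewness also its negative, so it is zero.\<close>

lemma quadratic_form_add_skew:
  assumes N: "(N :: real mat) \<in> carrier_mat n n" and G: "G \<in> carrier_mat n n" "G\<^sup>T = - G"
    and v: "v \<in> carrier_vec n"
  shows "v \<bullet> ((N + G) *\<^sub>v v) = v \<bullet> (N *\<^sub>v v)"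
proof -
  have "v \<bullet> (G\<^sup>T *\<^sub>v v) = - (v \<bullet> (G *\<^sub>v v))"
    unfolding G(2) using G v by simp
  with scalar_prod_transpose_mult[OF G(1) v v] have "v \<bullet> (G *\<^sub>v v) = 0" by simp
  then show ?thesis
    using assms by (simp add: add_mult_distrib_mat_vec[of _ n n] scalar_prod_add_distrib[of _ n]
      mult_mat_vec_carrier[of _ n n])
qed

lemma quadratic_form_four_block:
  assumes c: "(A :: 'a :: comm_ring mat) \<in> carrier_mat p p" "B \<in> carrier_mat p q"
    "C \<in> carrier_mat q p" "D \<in> carrier_mat q q"
    and v: "v \<in> carrier_vec p" and w: "w \<in> carrier_vec q"
  shows "(v @\<^sub>v w) \<bullet> (four_block_mat A B C D *\<^sub>v (v @\<^sub>v w))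
    = v \<bullet> (A *\<^sub>v v) + v \<bullet> (B *\<^sub>v w) + w \<bullet> (C *\<^sub>v v) + w \<bullet> (D *\<^sub>v w)"
proof -
  have "(v @\<^sub>v w) \<bullet> (four_block_mat A B C D *\<^sub>v (v @\<^sub>v w))
      = v \<bullet> (A *\<^sub>v v + B *\<^sub>v w) + w \<bullet> (C *\<^sub>v v + D *\<^sub>v w)"
    using assms by (subst four_block_mat_mult_vec[OF c v w])
      (intro scalar_prod_append add_carrier_vec mult_mat_vec_carrier; assumption)
  also have "v \<bullet> (A *\<^sub>v v + B *\<^sub>v w) = v \<bullet> (A *\<^sub>v v) + v \<bullet> (B *\<^sub>v w)"
    using assms by (intro scalar_prod_add_distrib mult_mat_vec_carrier)
  also have "w \<bullet> (C *\<^sub>v v + D *\<^sub>v w) = w \<bullet> (C *\<^sub>v v) + w \<bullet> (D *\<^sub>v w)"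
    using assms by (intro scalar_prod_add_distrib mult_mat_vec_carrier)
  finally show ?thesis by (simp add: add.assoc)
qed

text \<open>Splitting the test vector, v.(B w) = w.(B^T v), so the off-diagonal blocks enter only
  through C + B^T. Replacing \<open>A\<close> by its symmetric part prepares for the Schur
  complement, which is stated for symmetric \<open>H\<close>.\<close>

lemma psd_sym_part_mats_four_block_iff:
  assumes c: "A \<in> carrier_mat p p" "B \<in> carrier_mat p q" "C \<in> carrier_mat q p" "D \<in> carrier_mat q q"
  shows "four_block_mat A B C D \<in> psd_sym_part_mats (p + q) \<longleftrightarrow>
    (\<forall>v \<in> carrier_vec p. \<forall>w \<in> carrier_vec q.
      0 \<le> v \<bullet> (sym_part A *\<^sub>v v) + w \<bullet> ((C + B\<^sup>T) *\<^sub>v v) + w \<bullet> (D *\<^sub>v w))"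
    (is "?L \<longleftrightarrow> (\<forall>v \<in> _. \<forall>w \<in> _. 0 \<le> ?q v w)")
proof -
  have q: "(v @\<^sub>v w) \<bullet> (four_block_mat A B C D *\<^sub>v (v @\<^sub>v w)) = ?q v w"
    if v: "v \<in> carrier_vec p" and w: "w \<in> carrier_vec q" for v w :: "real vec"
  proof -
    have "w \<bullet> (B\<^sup>T *\<^sub>v v) = v \<bullet> (B *\<^sub>v w)" using scalar_prod_transpose_mult[OF c(2) w v] .
    then have "w \<bullet> ((C + B\<^sup>T) *\<^sub>v v) = v \<bullet> (B *\<^sub>v w) + w \<bullet> (C *\<^sub>v v)"
      using c v w by (simp add: add_mult_distrib_mat_vec[of _ q p] scalar_prod_add_distrib[of _ q]
        mult_mat_vec_carrier[of _ q p])
    then show ?thesis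
      unfolding quadratic_form_four_block[OF c v w] using c v by (simp add: quadratic_form_sym_part)
  qed
  have "?L \<longleftrightarrow> (\<forall>x \<in> carrier_vec (p + q). 0 \<le> x \<bullet> (four_block_mat A B C D *\<^sub>v x))"
    using c by (simp add: psd_sym_part_mats_iff)
  also have "\<dots> \<longleftrightarrow> (\<forall>v \<in> carrier_vec p. \<forall>w \<in> carrier_vec q. 0 \<le> ?q v w)"
  proof (intro iffI ballI)
    fix v w :: "real vec" assume vw: "v \<in> carrier_vec p" "w \<in> carrier_vec q"
      and "\<forall>x \<in> carrier_vec (p + q). 0 \<le> x \<bullet> (four_block_mat A B C D *\<^sub>v x)"
    then have "0 \<le> (v @\<^sub>v w) \<bullet> (four_block_mat A B C D *\<^sub>v (v @\<^sub>v w))" by simp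
    then show "0 \<le> ?q v w" unfolding q[OF vw] .
  next
    fix x :: "real vec" assume x: "x \<in> carrier_vec (p + q)"
      and h: "\<forall>v \<in> carrier_vec p. \<forall>w \<in> carrier_vec q. 0 \<le> ?q v w"
    have "0 \<le> ?q (vec_first x p) (vec_last x q)" using h by simp
    then have "0 \<le> (vec_first x p @\<^sub>v vec_last x q) \<bullet>
        (four_block_mat A B C D *\<^sub>v (vec_first x p @\<^sub>v vec_last x q))"
      by (subst q) auto
    then show "0 \<le> x \<bullet> (four_block_mat A B C D *\<^sub>v x)" using x by simp
  qed
  finally show ?thesis .
qed

text \<open>H H^+ H = H shows that H^+ H v and v have the same image under \<open>H\<close>. Their
  difference lies in the kernel of \<open>H\<close>, hence in that of \<open>K\<close>.\<close>

lemma mat_kernel_subset_pinv: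
  assumes H: "H \<in> carrier_mat p p" "H\<^sup>T = H" and K: "K \<in> carrier_mat q p"
    and ker: "mat_kernel H \<subseteq> mat_kernel K" and v: "v \<in> carrier_vec p"
  shows "K *\<^sub>v (pinv H *\<^sub>v (H *\<^sub>v v)) = K *\<^sub>v v"
proof -
  note P = pinv_symmetric[OF H]
  define z where "z = pinv H *\<^sub>v (H *\<^sub>v v)"
  have z: "z \<in> carrier_vec p" using P(1) H v by (simp add: z_def mult_mat_vec_carrier[of _ p p])
  have "H *\<^sub>v z = (H * pinv H * H) *\<^sub>v v"
    unfolding z_def using P(1) H v
    by (simp add: assoc_mult_mat_vec[of _ p p _ p] mult_mat_vec_carrier[of _ p p])
  then have "H *\<^sub>v z = H *\<^sub>v v" by (simp add: P)
  then have "H *\<^sub>v (z - v) = 0\<^sub>v p"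
    using H z v by (simp add: mult_minus_distrib_mat_vec[of _ p p] mult_mat_vec_carrier[of _ p p]
      minus_cancel_vec[of _ p])
  then have "z - v \<in> mat_kernel H" using H z v by (intro mat_kernelI) auto
  then have "K *\<^sub>v (z - v) = 0\<^sub>v q" using ker mat_kernelD(2)[OF K] by blast
  then have 0: "K *\<^sub>v z - K *\<^sub>v v = 0\<^sub>v q"
    using K z v by (simp add: mult_minus_distrib_mat_vec[of _ q p])
  show ?thesis unfolding z_def[symmetric]
  proof (rule eq_vecI)
    fix i assume i: "i < dim_vec (K *\<^sub>v v)"
    then have "(K *\<^sub>v z - K *\<^sub>v v) $ i = 0" using K by (simp add: 0)
    then show "(K *\<^sub>v z) $ i = (K *\<^sub>v v) $ i" using i by simp
  qed simp
qed

text \<open>Completing the square.\<close>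

lemma schur_complement_square:
  assumes H: "H \<in> carrier_mat p p" "H\<^sup>T = H" and K: "K \<in> carrier_mat q p"
    and D: "D \<in> carrier_mat q q" and ker: "mat_kernel H \<subseteq> mat_kernel K"
    and v: "v \<in> carrier_vec p" and w: "w \<in> carrier_vec q"
  defines "x \<equiv> v + (1/2) \<cdot>\<^sub>v (pinv H *\<^sub>v (K\<^sup>T *\<^sub>v w))"
  shows "v \<bullet> (H *\<^sub>v v) + w \<bullet> (K *\<^sub>v v) + w \<bullet> (D *\<^sub>v w)
    = x \<bullet> (H *\<^sub>v x) + w \<bullet> ((D - (1/4) \<cdot>\<^sub>m (K * pinv H * K\<^sup>T)) *\<^sub>v w)"
proof -
  note P = pinv_symmetric[OF H]
  define y where "y = pinv H *\<^sub>v (K\<^sup>T *\<^sub>v w)"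
  have KT: "K\<^sup>T \<in> carrier_mat p q" using K by simp
  have y: "y \<in> carrier_vec p"
    unfolding y_def using P(1) KT w by (intro mult_mat_vec_carrier)
  have Hc: "H *\<^sub>v u \<in> carrier_vec p" "pinv H *\<^sub>v u \<in> carrier_vec p" if "u \<in> carrier_vec p" for u
    using that H P(1) by auto
  \<comment> \<open>With y = H^+ K^T w the coupling term becomes an \<open>H\<close>-product with
    \<open>y\<close>, so x = v + y/2 absorbs it. The kernel inclusion enters here.\<close>
  have yH: "y \<bullet> (H *\<^sub>v u) = w \<bullet> (K *\<^sub>v u)" if u: "u \<in> carrier_vec p" for u
  proof -
    have "y \<bullet> (H *\<^sub>v u) = (K\<^sup>T *\<^sub>v w) \<bullet> (pinv H *\<^sub>v (H *\<^sub>v u))"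
      unfolding y_def
      using transpose_vec_mult_scalar[OF P(1) Hc(1)[OF u] mult_mat_vec_carrier[OF KT w]]
      by (simp add: P)
    also have "\<dots> = w \<bullet> (K *\<^sub>v (pinv H *\<^sub>v (H *\<^sub>v u)))"
      by (intro transpose_vec_mult_scalar[OF K _ w] Hc u)
    finally show ?thesis by (simp add: mat_kernel_subset_pinv[OF H K ker u])
  qed
  have sym: "v \<bullet> (H *\<^sub>v y) = w \<bullet> (K *\<^sub>v v)"
    using scalar_prod_transpose_mult[OF H(1) v y] by (simp add: H(2) yH[OF v])
  have x: "x = v + (1/2) \<cdot>\<^sub>v y" by (simp add: x_def y_def)
  have "H *\<^sub>v x = H *\<^sub>v v + (1/2) \<cdot>\<^sub>v (H *\<^sub>v y)"
    unfolding x using H v y by (simp add: mult_add_distrib_mat_vec[of _ p p] mult_mat_vec[of _ p p])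
  then have "x \<bullet> (H *\<^sub>v x) = v \<bullet> (H *\<^sub>v v) + 1/2 * (v \<bullet> (H *\<^sub>v y))
      + 1/2 * (y \<bullet> (H *\<^sub>v v)) + 1/4 * (y \<bullet> (H *\<^sub>v y))"
    unfolding x using v y Hc
    by (simp add: scalar_prod_add_distrib[of _ p] add_scalar_prod_distrib[of _ p])
  then have xHx: "x \<bullet> (H *\<^sub>v x) = v \<bullet> (H *\<^sub>v v) + w \<bullet> (K *\<^sub>v v) + 1/4 * (w \<bullet> (K *\<^sub>v y))"
    by (simp add: sym yH v y)
  have c: "K * pinv H \<in> carrier_mat q p" "K * pinv H * K\<^sup>T \<in> carrier_mat q q"
    using K P(1) by (auto simp del: assoc_mult_mat)
  have "(K * pinv H * K\<^sup>T) *\<^sub>v w = K *\<^sub>v y"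
    unfolding y_def using K P(1) KT w c
    by (simp add: assoc_mult_mat_vec[of "K * pinv H" q p "K\<^sup>T" q]
      assoc_mult_mat_vec[of K q p "pinv H" p] mult_mat_vec_carrier[of _ p q] del: assoc_mult_mat)
  then have "w \<bullet> ((D - (1/4) \<cdot>\<^sub>m (K * pinv H * K\<^sup>T)) *\<^sub>v w)
      = w \<bullet> (D *\<^sub>v w) - 1/4 * (w \<bullet> (K *\<^sub>v y))"
    using D c w by (simp add: minus_mult_distrib_mat_vec[of _ q q] scalar_prod_minus_distrib[of _ q]
      mult_mat_vec_carrier[of _ q q] scalar_prod_smult_mat_vec[of _ q q] del: assoc_mult_mat)
  with xHx show ?thesis by simp
qed

text \<open>After completing the square, positivity means that both summands are nonnegative. The
  factor 1/4 appears because \<open>K\<close> carries the whole cross term, so the off-diagonal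
  block of the symmetric part is K/2.\<close>

lemma schur_complement_iff:
  assumes H: "H \<in> carrier_mat p p" "H\<^sup>T = H" and K: "K \<in> carrier_mat q p"
    and D: "D \<in> carrier_mat q q"
  shows "(\<forall>v \<in> carrier_vec p. \<forall>w \<in> carrier_vec q.
      0 \<le> v \<bullet> (H *\<^sub>v v) + w \<bullet> (K *\<^sub>v v) + w \<bullet> (D *\<^sub>v w)) \<longleftrightarrow>
    (\<forall>v \<in> carrier_vec p. 0 \<le> v \<bullet> (H *\<^sub>v v)) \<and> mat_kernel H \<subseteq> mat_kernel K \<and>
    (\<forall>w \<in> carrier_vec q. 0 \<le> w \<bullet> ((D - (1/4) \<cdot>\<^sub>m (K * pinv H * K\<^sup>T)) *\<^sub>v w))"
    (is "?L \<longleftrightarrow> ?R")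
proof
  assume L: ?L
  have Hpsd: "\<forall>v \<in> carrier_vec p. 0 \<le> v \<bullet> (H *\<^sub>v v)"
  proof
    fix v :: "real vec" assume v: "v \<in> carrier_vec p"
    have "0 \<le> v \<bullet> (H *\<^sub>v v) + 0\<^sub>v q \<bullet> (K *\<^sub>v v) + 0\<^sub>v q \<bullet> (D *\<^sub>v 0\<^sub>v q)"
      using L v by simp
    then show "0 \<le> v \<bullet> (H *\<^sub>v v)"
      using K D v by (simp add: mult_mat_vec_carrier[of _ q p] mult_mat_vec_carrier[of _ q q])
  qed
  have ker: "mat_kernel H \<subseteq> mat_kernel K"
  proof
    fix z assume "z \<in> mat_kernel H"
    then have z: "z \<in> carrier_vec p" "H *\<^sub>v z = 0\<^sub>v p" using mat_kernelD[OF H(1)] by auto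
    define u where "u = K *\<^sub>v z"
    have u: "u \<in> carrier_vec q" using K z by (simp add: u_def mult_mat_vec_carrier[of _ q p])
    define d where "d = u \<bullet> (D *\<^sub>v u)"
    \<comment> \<open>Along t z with z in the kernel of \<open>H\<close> and w = u = K z, the form
      is affine in t with slope u.u. A nonzero slope would allow the value -1.\<close>
    have *: "0 \<le> t * (u \<bullet> u) + d" for t
    proof -
      have "0 \<le> (t \<cdot>\<^sub>v z) \<bullet> (H *\<^sub>v (t \<cdot>\<^sub>v z)) + u \<bullet> (K *\<^sub>v (t \<cdot>\<^sub>v z)) + u \<bullet> (D *\<^sub>v u)"
        using L z(1) u by simp
      also have "H *\<^sub>v (t \<cdot>\<^sub>v z) = 0\<^sub>v p" using H z
        by (subst mult_mat_vec[of _ p p]) (auto intro!: eq_vecI)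
      also have "K *\<^sub>v (t \<cdot>\<^sub>v z) = t \<cdot>\<^sub>v u" using K z by (simp add: mult_mat_vec[of _ q p] u_def)
      finally show ?thesis using u z by (simp add: d_def scalar_prod_smult_distrib[of _ q])
    qed
    have "u \<bullet> u = 0"
    proof (rule ccontr)
      assume "u \<bullet> u \<noteq> 0"
      then have "(- (d + 1) / (u \<bullet> u)) * (u \<bullet> u) + d = -1" by simp
      with *[of "- (d + 1) / (u \<bullet> u)"] show False by simp
    qed
    then have "u = 0\<^sub>v q"
      using u by (intro eq_vecI) (auto simp: scalar_prod_def sum_nonneg_eq_0_iff)
    then show "z \<in> mat_kernel K" using K z by (intro mat_kernelI) (auto simp: u_def)
  qed
  have "0 \<le> w \<bullet> ((D - (1/4) \<cdot>\<^sub>m (K * pinv H * K\<^sup>T)) *\<^sub>v w)" if w: "w \<in> carrier_vec q" for w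
  proof -
    define y where "y = pinv H *\<^sub>v (K\<^sup>T *\<^sub>v w)"
    have y: "y \<in> carrier_vec p" unfolding y_def using pinv_symmetric(1)[OF H] K w
      by (intro mult_mat_vec_carrier[of _ p p] mult_mat_vec_carrier[of _ p q]) auto
    \<comment> \<open>This choice of \<open>v\<close> makes the completed square vanish, leaving
      only the Schur complement.\<close>
    define v where "v = - (1/2) \<cdot>\<^sub>v y"
    have v: "v \<in> carrier_vec p" using y by (simp add: v_def)
    have x: "v + (1/2) \<cdot>\<^sub>v y = 0\<^sub>v p" unfolding v_def using y by (intro eq_vecI) auto
    have "H *\<^sub>v 0\<^sub>v p \<in> carrier_vec p" using H by simp
    then show ?thesis
      using schur_complement_square[OF H K D ker v w] L[rule_format, OF v w]
      unfolding y_def[symmetric] x by simp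
  qed
  with Hpsd ker show ?R by blast
next
  assume R: ?R
  show ?L
  proof (intro ballI)
    fix v w :: "real vec" assume v: "v \<in> carrier_vec p" and w: "w \<in> carrier_vec q"
    have "v + (1/2) \<cdot>\<^sub>v (pinv H *\<^sub>v (K\<^sup>T *\<^sub>v w)) \<in> carrier_vec p"
      using pinv_symmetric(1)[OF H] K w v
      by (intro add_carrier_vec iffD2[OF smult_carrier_vec] mult_mat_vec_carrier[of _ p p]
        mult_mat_vec_carrier[of _ p q]) auto
    then show "0 \<le> v \<bullet> (H *\<^sub>v v) + w \<bullet> (K *\<^sub>v v) + w \<bullet> (D *\<^sub>v w)"
      using R w schur_complement_square[OF H K D _ v w] by auto
  qed
qed

subsection \<open>The reduced problem\<close>

lemma frob_norm_sq: "(frob_norm A)\<^sup>2 = (\<Sum>i<dim_row A. \<Sum>j<dim_col A. (A $$ (i,j))\<^sup>2)"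
  unfolding frob_norm_def by (simp add: sum_nonneg)

lemma frob_norm_sq_eq_0_iff:
  assumes A: "A \<in> carrier_mat n m"
  shows "(frob_norm A)\<^sup>2 = 0 \<longleftrightarrow> A = 0\<^sub>m n m"
proof
  assume "(frob_norm A)\<^sup>2 = 0"
  then have "A $$ (i,j) = 0" if "i < n" "j < m" for i j
    using A that unfolding frob_norm_sq by (simp add: sum_nonneg_eq_0_iff sum_nonneg)
  then show "A = 0\<^sub>m n m" using A by (intro eq_matI) auto
qed (simp add: frob_norm_sq)

lemma index_mult_diagonal:
  assumes A: "(A :: 'a :: semiring_0 mat) \<in> carrier_mat n r"
    and S: "S \<in> carrier_mat r r" "diagonal_mat S" and ij: "i < n" "j < r"
  shows "(A * S) $$ (i,j) = A $$ (i,j) * S $$ (j,j)"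
proof -
  have "(A * S) $$ (i,j) = (\<Sum>k = 0..<r. A $$ (i,k) * S $$ (k,j))"
    using A S ij by (simp add: scalar_prod_def)
  also have "\<dots> = (\<Sum>k = 0..<r. if k = j then A $$ (i,j) * S $$ (j,j) else 0)"
    using S ij by (intro sum.cong) (auto simp: diagonal_mat_def)
  finally show ?thesis using ij by simp
qed

lemma quadratic_form_sum:
  assumes "(A :: 'a :: comm_ring mat) \<in> carrier_mat n n" "v \<in> carrier_vec n"
  shows "v \<bullet> (A *\<^sub>v v) = (\<Sum>i = 0..<n. v $ i * (\<Sum>j = 0..<n. A $$ (i,j) * v $ j))"
  using assms by (simp add: scalar_prod_def)

lemma zero_in_psd_sym_part_mats: "0\<^sub>m n n \<in> psd_sym_part_mats n"
  by (auto simp: psd_sym_part_mats_iff quadratic_form_sum[of _ n])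

text \<open>Midpoint convexity is the form of convexity that the parallelogram argument
  consumes.\<close>

lemma midpoint_in_psd_sym_part_mats:
  assumes "A \<in> psd_sym_part_mats n" "A' \<in> psd_sym_part_mats n"
  shows "(1/2) \<cdot>\<^sub>m (A + A') \<in> psd_sym_part_mats n"
  using assms by (simp add: psd_sym_part_mats_iff scalar_prod_smult_mat_vec[of _ n n]
      add_mult_distrib_mat_vec[of _ n n] scalar_prod_add_distrib[of _ n]
      mult_mat_vec_carrier[of _ n n])

text \<open>For a fixed vector the quadratic form is a finite polynomial expression in the entries,
  so nonnegativity survives entrywise limits.\<close>

lemma psd_sym_part_mats_closed:
  assumes A: "\<And>k. A k \<in> psd_sym_part_mats n" and L: "L \<in> carrier_mat n n"
    and lim: "\<And>i j. i < n \<Longrightarrow> j < n \<Longrightarrow> (\<lambda>k. A k $$ (i,j)) \<longlonglongrightarrow> L $$ (i,j)"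
  shows "L \<in> psd_sym_part_mats n"
  unfolding psd_sym_part_mats_iff
proof (intro conjI ballI)
  fix v :: "real vec" assume v: "v \<in> carrier_vec n"
  have Ak: "A k \<in> carrier_mat n n" "0 \<le> v \<bullet> (A k *\<^sub>v v)" for k
    using A[of k] v by (auto simp: psd_sym_part_mats_iff)
  have "(\<lambda>k. v \<bullet> (A k *\<^sub>v v)) \<longlonglongrightarrow> v \<bullet> (L *\<^sub>v v)"
    unfolding quadratic_form_sum[OF L v] quadratic_form_sum[OF Ak(1) v]
    by (intro tendsto_intros lim) auto
  then show "0 \<le> v \<bullet> (L *\<^sub>v v)" using Ak(2) by (intro LIMSEQ_le_const) auto
qed (rule L)

section \<open>Unique solvability of the least-squares problem with positive diagonal weight\<close>

context
  fixes r :: nat and S C :: "real mat" and f :: "real mat \<Rightarrow> real"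
  assumes S: "S \<in> carrier_mat r r" "diagonal_mat S" "\<forall>i<r. S $$ (i,i) > 0"
    and C: "C \<in> carrier_mat r r"
  defines "f \<equiv> (\<lambda>A. (frob_norm (A * S - C))\<^sup>2)"
begin

text \<open>Diagonality of \<open>S\<close> decouples the residual into scalar squares, so that
  identities and limits can be treated entry by entry.\<close>

lemma diagonal_residual_sum:
  assumes "A \<in> carrier_mat r r"
  shows "f A = (\<Sum>i<r. \<Sum>j<r. (A $$ (i,j) * S $$ (j,j) - C $$ (i,j))\<^sup>2)"
  unfolding f_def frob_norm_sq using assms S C
  by (auto intro!: sum.cong simp: index_mult_diagonal[of _ r r] simp del: index_mult_mat(1))

text \<open>In each entry this is (a - b)^2 = 2 a^2 + 2 b^2 - 4 ((a + b)/2)^2 for the two residuals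
  a and b; \<open>C\<close> cancels in their difference.\<close>

lemma diagonal_residual_parallelogram:
  assumes "A \<in> carrier_mat r r" "A' \<in> carrier_mat r r"
  shows "(\<Sum>i<r. \<Sum>j<r. ((A $$ (i,j) - A' $$ (i,j)) * S $$ (j,j))\<^sup>2)
    = 2 * f A + 2 * f A' - 4 * f ((1/2) \<cdot>\<^sub>m (A + A'))"
proof -
  have M: "(1/2) \<cdot>\<^sub>m (A + A') \<in> carrier_mat r r" using assms by simp
  show ?thesis
    unfolding diagonal_residual_sum[OF assms(1)] diagonal_residual_sum[OF assms(2)]
      diagonal_residual_sum[OF M] sum_distrib_left sum.distrib[symmetric] sum_subtractf[symmetric]
    using assms by (intro sum.cong) (auto simp: power2_eq_square field_simps)
qed

text \<open>One square is at most the whole sum, and the midpoint is feasible, so its value is at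
  least \<open>c\<close>. With \<open>c\<close> the minimum this gives uniqueness; with
  \<open>c\<close> the infimum it gives the Cauchy property.\<close>

lemma diagonal_residual_entry_dist:
  assumes A: "A \<in> psd_sym_part_mats r" "A' \<in> psd_sym_part_mats r"
    and lb: "\<And>A. A \<in> psd_sym_part_mats r \<Longrightarrow> c \<le> f A" and ij: "i < r" "j < r"
  shows "((A $$ (i,j) - A' $$ (i,j)) * S $$ (j,j))\<^sup>2 \<le> 2 * f A + 2 * f A' - 4 * c"
proof -
  have c: "A \<in> carrier_mat r r" "A' \<in> carrier_mat r r"
    using A by (auto simp: psd_sym_part_mats_iff)
  have "((A $$ (i,j) - A' $$ (i,j)) * S $$ (j,j))\<^sup>2
      \<le> (\<Sum>j<r. ((A $$ (i,j) - A' $$ (i,j)) * S $$ (j,j))\<^sup>2)"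
    using ij by (intro member_le_sum) auto
  also have "\<dots> \<le> (\<Sum>i<r. \<Sum>j<r. ((A $$ (i,j) - A' $$ (i,j)) * S $$ (j,j))\<^sup>2)"
    using ij by (intro member_le_sum[where f = "\<lambda>i. \<Sum>j<r. ((A $$ (i,j) - A' $$ (i,j)) * S $$ (j,j))\<^sup>2"])
      (auto intro: sum_nonneg)
  also have "\<dots> \<le> 2 * f A + 2 * f A' - 4 * c"
    unfolding diagonal_residual_parallelogram[OF c]
    using lb[OF midpoint_in_psd_sym_part_mats[OF A]] by simp
  finally show ?thesis .
qed

lemma diagonal_residual_minimizer_unique:
  assumes A: "is_arg_min f (\<lambda>A. A \<in> psd_sym_part_mats r) A"
    and A': "is_arg_min f (\<lambda>A. A \<in> psd_sym_part_mats r) A'"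
  shows "A = A'"
proof (rule eq_matI)
  have c: "A \<in> carrier_mat r r" "A' \<in> carrier_mat r r"
    using A A' by (auto simp: psd_sym_part_mats_iff is_arg_min_def)
  have eq: "f A' = f A" using A A' unfolding is_arg_min_linorder by (meson antisym)
  show "dim_row A = dim_row A'" "dim_col A = dim_col A'" using c by auto
  fix i j assume "i < dim_row A'" "j < dim_col A'"
  then have ij: "i < r" "j < r" using c by auto
  have "((A $$ (i,j) - A' $$ (i,j)) * S $$ (j,j))\<^sup>2 \<le> 2 * f A + 2 * f A' - 4 * f A"
    using A A' ij by (intro diagonal_residual_entry_dist) (auto simp: is_arg_min_linorder)
  then have "(A $$ (i,j) - A' $$ (i,j)) * S $$ (j,j) = 0" by (simp add: eq)
  then show "A $$ (i,j) = A' $$ (i,j)" using S(3) ij by auto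
qed

text \<open>By the parallelogram identity every minimizing sequence is entrywise Cauchy.\<close>

lemma diagonal_residual_minimizer_exists:
  "\<exists>A. is_arg_min f (\<lambda>A. A \<in> psd_sym_part_mats r) A"
proof -
  define c where "c = (INF A \<in> psd_sym_part_mats r. f A)"
  have bdd: "bdd_below (f ` psd_sym_part_mats r)"
    by (intro bdd_belowI[of _ 0]) (auto simp: f_def)
  have ne: "psd_sym_part_mats r \<noteq> {}" using zero_in_psd_sym_part_mats by blast
  have lb: "c \<le> f A" if "A \<in> psd_sym_part_mats r" for A
    unfolding c_def using bdd that by (rule cINF_lower)
  have "\<exists>A \<in> psd_sym_part_mats r. f A < c + inverse (real (Suc k))" for k
    using cINF_less_iff[OF ne bdd, of "c + inverse (real (Suc k))"] unfolding c_def by auto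
  then obtain A where A: "\<And>k. A k \<in> psd_sym_part_mats r"
    and fA: "\<And>k. f (A k) < c + inverse (real (Suc k))" by metis
  have Ac: "A k \<in> carrier_mat r r" for k using A[of k] by (simp add: psd_sym_part_mats_iff)
  have conv: "convergent (\<lambda>k. A k $$ (i,j))" if ij: "i < r" "j < r" for i j
  proof (rule Cauchy_convergent, rule metric_CauchyI)
    fix e :: real assume e: "0 < e"
    define s where "s = S $$ (j,j)"
    have s: "s > 0" using S(3) ij by (simp add: s_def)
    \<comment> \<open>Both values exceed \<open>c\<close> by less than
      \<open>inverse (Suc N)\<close>, so the weighted square is below four times that; hence the
      quarter. The positive weight \<open>s\<close> is divided out at the end.\<close>
    have "0 < (e * s)\<^sup>2 / 4" using e s by simp
    then obtain N where N: "inverse (real (Suc N)) < (e * s)\<^sup>2 / 4" by (rule reals_Archimedean[THEN exE])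
    have "dist (A k $$ (i,j)) (A l $$ (i,j)) < e" if kl: "k \<ge> N" "l \<ge> N" for k l
    proof -
      have "((A k $$ (i,j) - A l $$ (i,j)) * s)\<^sup>2 \<le> 2 * f (A k) + 2 * f (A l) - 4 * c"
        unfolding s_def using ij by (intro diagonal_residual_entry_dist A lb)
      also have "\<dots> < 2 * inverse (real (Suc k)) + 2 * inverse (real (Suc l))"
        using fA[of k] fA[of l] by simp
      also have "\<dots> \<le> 2 * inverse (real (Suc N)) + 2 * inverse (real (Suc N))"
        using kl by (intro add_mono mult_left_mono le_imp_inverse_le) auto
      also have "\<dots> < (e * s)\<^sup>2" using N by simp
      finally have "\<bar>(A k $$ (i,j) - A l $$ (i,j)) * s\<bar> < e * s"
        using e s by (intro power2_less_imp_less[of "\<bar>_\<bar>"]) auto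
      then show ?thesis using s by (simp add: abs_mult dist_real_def)
    qed
    then show "\<exists>N. \<forall>k\<ge>N. \<forall>l\<ge>N. dist (A k $$ (i,j)) (A l $$ (i,j)) < e" by blast
  qed
  define L where "L = mat r r (\<lambda>(i,j). lim (\<lambda>k. A k $$ (i,j)))"
  have L: "L \<in> carrier_mat r r" by (simp add: L_def)
  have lim: "(\<lambda>k. A k $$ (i,j)) \<longlonglongrightarrow> L $$ (i,j)" if "i < r" "j < r" for i j
    using conv[OF that] that by (simp add: L_def convergent_LIMSEQ_iff)
  have LC: "L \<in> psd_sym_part_mats r" by (rule psd_sym_part_mats_closed[OF A L lim])
  \<comment> \<open>The residual is continuous in the entries, so the limit inherits the infimum as
    an upper bound on its value.\<close>
  have "(\<lambda>k. f (A k)) \<longlonglongrightarrow> f L"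
    unfolding diagonal_residual_sum[OF L] diagonal_residual_sum[OF Ac]
    by (intro tendsto_intros lim) auto
  moreover have "(\<lambda>k. c + inverse (real (Suc k))) \<longlonglongrightarrow> c + 0"
    by (intro tendsto_intros LIMSEQ_inverse_real_of_nat)
  ultimately have "f L \<le> c + 0"
    using fA by (intro LIMSEQ_le) (auto intro: less_imp_le)
  with LC lb show ?thesis unfolding is_arg_min_linorder by force
qed

end

subsection \<open>Block decompositions\<close>

lemma frob_norm_sq_transpose: "(frob_norm A\<^sup>T)\<^sup>2 = (frob_norm A)\<^sup>2"
  unfolding frob_norm_sq by (simp, subst sum.swap) simp

lemma frob_norm_sq_zero_minus:
  "A \<in> carrier_mat n m \<Longrightarrow> (frob_norm (0\<^sub>m n m - A))\<^sup>2 = (frob_norm A)\<^sup>2"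
  unfolding frob_norm_sq by simp

lemma frob_norm_sq_cols: "(frob_norm A)\<^sup>2 = (\<Sum>j<dim_col A. col A j \<bullet> col A j)"
  unfolding frob_norm_sq
  by (subst sum.swap) (simp add: scalar_prod_def power2_eq_square lessThan_atLeast0)

text \<open>The squared norm is the sum of the squared column lengths, and U^T U = 1 preserves each
  of them.\<close>

lemma frob_norm_sq_isometry_mult:
  assumes U: "U \<in> carrier_mat k n" "U\<^sup>T * U = 1\<^sub>m n" and A: "A \<in> carrier_mat n m"
  shows "(frob_norm (U * A))\<^sup>2 = (frob_norm A)\<^sup>2"
proof -
  have "col (U * A) j \<bullet> col (U * A) j = col A j \<bullet> col A j" if j: "j < m" for j
  proof -
    have c: "col A j \<in> carrier_vec n" "U *\<^sub>v col A j \<in> carrier_vec k"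
      using U A j by (auto simp: mult_mat_vec_carrier[of _ k n])
    have "col (U * A) j = U *\<^sub>v col A j" using U A j by (intro eq_vecI) auto
    then have "col (U * A) j \<bullet> col (U * A) j = (U\<^sup>T *\<^sub>v (U *\<^sub>v col A j)) \<bullet> col A j"
      using transpose_vec_mult_scalar[OF U(1) c] by simp
    also have "U\<^sup>T *\<^sub>v (U *\<^sub>v col A j) = (U\<^sup>T * U) *\<^sub>v col A j"
      using U(1) c by (simp add: assoc_mult_mat_vec[of _ n k _ n])
    finally show ?thesis using c by (simp add: U(2))
  qed
  then show ?thesis unfolding frob_norm_sq_cols using A by simp
qed

lemma frob_norm_sq_mult_transpose_isometry:
  assumes V: "V \<in> carrier_mat k m" "V\<^sup>T * V = 1\<^sub>m m" and A: "A \<in> carrier_mat n m"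
  shows "(frob_norm (A * V\<^sup>T))\<^sup>2 = (frob_norm A)\<^sup>2"
proof -
  have "(A * V\<^sup>T)\<^sup>T = V * A\<^sup>T" using V A by (simp add: transpose_mult[of _ n m _ k])
  then have "(frob_norm (A * V\<^sup>T))\<^sup>2 = (frob_norm (V * A\<^sup>T))\<^sup>2"
    by (metis frob_norm_sq_transpose)
  also have "\<dots> = (frob_norm A)\<^sup>2"
    using A by (simp add: frob_norm_sq_isometry_mult[OF V, of _ n] frob_norm_sq_transpose)
  finally show ?thesis .
qed

lemma frob_norm_sq_four_block:
  assumes "A \<in> carrier_mat a c" "B \<in> carrier_mat a d" "C \<in> carrier_mat b c" "D \<in> carrier_mat b d"
  shows "(frob_norm (four_block_mat A B C D))\<^sup>2
    = (frob_norm A)\<^sup>2 + (frob_norm B)\<^sup>2 + (frob_norm C)\<^sup>2 + (frob_norm D)\<^sup>2"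
proof -
  have split: "(\<Sum>i<x + y. h i) = (\<Sum>i<x. h i) + (\<Sum>i<y. h (x + i))"
    for x y and h :: "nat \<Rightarrow> real"
    by (induction y) auto
  show ?thesis
    unfolding frob_norm_sq using assms by (simp add: split sum.distrib)
qed

lemma minus_four_block_mat:
  assumes "A \<in> carrier_mat a c" "B \<in> carrier_mat a d" "C \<in> carrier_mat b c" "D \<in> carrier_mat b d"
    and "A' \<in> carrier_mat a c" "B' \<in> carrier_mat a d" "C' \<in> carrier_mat b c" "D' \<in> carrier_mat b d"
  shows "four_block_mat A B C D - four_block_mat A' B' C' D'
    = four_block_mat (A - A') (B - B') (C - C') (D - D')"
  using assms by (intro eq_matI) auto

section \<open>Block algebra for adjoined columns\<close>

lemma append_cols_carrier:
  "A \<in> carrier_mat n p \<Longrightarrow> B \<in> carrier_mat n q \<Longrightarrow> append_cols A B \<in> carrier_mat n (p + q)"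
  by (auto simp: append_cols_def)

text \<open>Adjoining an empty block allows a single matrix such as B V2 to be treated by the rules
  for adjoined columns.\<close>

lemma append_cols_zero_cols: "A \<in> carrier_mat n p \<Longrightarrow> append_cols A (0\<^sub>m n 0) = A"
  unfolding append_cols_def by (intro eq_matI) auto

lemma append_cols_mult_four_block:
  assumes "U1 \<in> carrier_mat n p" "U2 \<in> carrier_mat n q"
    and "A \<in> carrier_mat p c" "B \<in> carrier_mat p d" "C \<in> carrier_mat q c" "D \<in> carrier_mat q d"
  shows "append_cols U1 U2 * four_block_mat A B C D
    = append_cols (U1 * A + U2 * C) (U1 * B + U2 * D)"
  unfolding append_cols_def using assms
  by (subst mult_four_block_mat[of _ n p _ q _ 0 _ _ c _ d]) auto

text \<open>An adjoined pair is a four-block matrix with an empty lower row, and its transpose has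
  an empty right column; the product rule for blocks then leaves only the upper left block.\<close>

lemma append_cols_mult_transpose:
  assumes "P \<in> carrier_mat k p" "Q \<in> carrier_mat k q" "U1 \<in> carrier_mat n p" "U2 \<in> carrier_mat n q"
  shows "append_cols P Q * (append_cols U1 U2)\<^sup>T = P * U1\<^sup>T + Q * U2\<^sup>T"
proof -
  have "append_cols P Q * (append_cols U1 U2)\<^sup>T = four_block_mat P Q (0\<^sub>m 0 p) (0\<^sub>m 0 q) *
      four_block_mat U1\<^sup>T (0\<^sub>m p 0) U2\<^sup>T (0\<^sub>m q 0)"
    unfolding append_cols_def using assms
    by (subst transpose_four_block_mat[of _ n p _ q _ 0]) auto
  also have "\<dots> = four_block_mat (P * U1\<^sup>T + Q * U2\<^sup>T) (0\<^sub>m k 0) (0\<^sub>m 0 n) (0\<^sub>m 0 0)"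
    using assms by (subst mult_four_block_mat[of _ k p _ q _ 0 _ _ n _ 0]) auto
  also have "\<dots> = P * U1\<^sup>T + Q * U2\<^sup>T"
    using assms by (intro eq_matI) auto
  finally show ?thesis .
qed

lemma mult_append_cols:
  assumes "M \<in> carrier_mat k n" "V1 \<in> carrier_mat n p" "V2 \<in> carrier_mat n q"
  shows "M * append_cols V1 V2 = append_cols (M * V1) (M * V2)"
  unfolding append_cols_def using assms
  by (intro eq_matI) (auto simp: scalar_prod_def intro!: sum.cong)

lemma transpose_append_cols_mult_append_cols:
  assumes "U1 \<in> carrier_mat n a" "U2 \<in> carrier_mat n b" "W1 \<in> carrier_mat n c" "W2 \<in> carrier_mat n d"
  shows "(append_cols U1 U2)\<^sup>T * append_cols W1 W2
    = four_block_mat (U1\<^sup>T * W1) (U1\<^sup>T * W2) (U2\<^sup>T * W1) (U2\<^sup>T * W2)"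
proof -
  have "(append_cols U1 U2)\<^sup>T * append_cols W1 W2
      = four_block_mat U1\<^sup>T (0\<^sub>m a 0) U2\<^sup>T (0\<^sub>m b 0) * four_block_mat W1 W2 (0\<^sub>m 0 c) (0\<^sub>m 0 d)"
    unfolding append_cols_def using assms
    by (subst transpose_four_block_mat[of _ n a _ b _ 0]) auto
  also have "\<dots> = four_block_mat (U1\<^sup>T * W1) (U1\<^sup>T * W2) (U2\<^sup>T * W1) (U2\<^sup>T * W2)"
    using assms by (subst mult_four_block_mat[of _ a n _ 0 _ b _ _ c _ d]) auto
  finally show ?thesis .
qed

text \<open>This converts the block form of a solution into its expansion in \<open>U1\<close> and
  \<open>U2\<close>.\<close>

lemma conjugate_append_cols:
  assumes "U1 \<in> carrier_mat n p" "U2 \<in> carrier_mat n q"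
    and "A \<in> carrier_mat p p" "B \<in> carrier_mat p q" "C \<in> carrier_mat q p" "D \<in> carrier_mat q q"
  shows "append_cols U1 U2 * four_block_mat A B C D * (append_cols U1 U2)\<^sup>T
    = U1 * A * U1\<^sup>T + U2 * C * U1\<^sup>T + U1 * B * U2\<^sup>T + U2 * D * U2\<^sup>T"
proof -
  have c: "U1 * A + U2 * C \<in> carrier_mat n p" "U1 * B + U2 * D \<in> carrier_mat n q"
    "U1 * A \<in> carrier_mat n p" "U2 * C \<in> carrier_mat n p"
    "U1 * B \<in> carrier_mat n q" "U2 * D \<in> carrier_mat n q"
    "U1 * A * U1\<^sup>T \<in> carrier_mat n n" "U2 * C * U1\<^sup>T \<in> carrier_mat n n"
    "U1 * B * U2\<^sup>T \<in> carrier_mat n n" "U2 * D * U2\<^sup>T \<in> carrier_mat n n"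
    using assms by (auto simp del: assoc_mult_mat)
  have "append_cols U1 U2 * four_block_mat A B C D * (append_cols U1 U2)\<^sup>T
      = (U1 * A + U2 * C) * U1\<^sup>T + (U1 * B + U2 * D) * U2\<^sup>T"
    unfolding append_cols_mult_four_block[OF assms] append_cols_mult_transpose[OF c(1,2) assms(1,2)] ..
  also have "(U1 * A + U2 * C) * U1\<^sup>T = U1 * A * U1\<^sup>T + U2 * C * U1\<^sup>T"
    using c assms by (intro add_mult_distrib_mat[of _ n p]) auto
  also have "(U1 * B + U2 * D) * U2\<^sup>T = U1 * B * U2\<^sup>T + U2 * D * U2\<^sup>T"
    using c assms by (intro add_mult_distrib_mat[of _ n q]) auto
  also have "U1 * A * U1\<^sup>T + U2 * C * U1\<^sup>T + (U1 * B * U2\<^sup>T + U2 * D * U2\<^sup>T)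
      = U1 * A * U1\<^sup>T + U2 * C * U1\<^sup>T + U1 * B * U2\<^sup>T + U2 * D * U2\<^sup>T"
    using c by (intro assoc_add_mat[of _ n n, symmetric]) (auto simp del: assoc_mult_mat)
  finally show ?thesis .
qed

lemma transpose_append_cols_mult_mult_append_cols:
  assumes U: "U1 \<in> carrier_mat n a" "U2 \<in> carrier_mat n b" and B: "B \<in> carrier_mat n m"
    and V: "V1 \<in> carrier_mat m c" "V2 \<in> carrier_mat m d"
  shows "(append_cols U1 U2)\<^sup>T * B * append_cols V1 V2
    = four_block_mat (U1\<^sup>T * B * V1) (U1\<^sup>T * B * V2) (U2\<^sup>T * B * V1) (U2\<^sup>T * B * V2)"
proof -
  have "(append_cols U1 U2)\<^sup>T * B * append_cols V1 V2
      = (append_cols U1 U2)\<^sup>T * append_cols (B * V1) (B * V2)"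
    using append_cols_carrier[OF U] append_cols_carrier[OF V] B
    by (simp add: assoc_mult_mat[of _ "a + b" n _ m _ "c + d"] mult_append_cols[OF B V])
  also have "\<dots> = four_block_mat (U1\<^sup>T * (B * V1)) (U1\<^sup>T * (B * V2)) (U2\<^sup>T * (B * V1)) (U2\<^sup>T * (B * V2))"
    using U B V by (intro transpose_append_cols_mult_append_cols[of _ n a _ b _ c _ d]) auto
  finally show ?thesis
    using U B V by (simp add: assoc_mult_mat[of _ a n _ m] assoc_mult_mat[of _ b n _ m])
qed

text \<open>The form at v is the form of \<open>T\<close> at W^T v. Used with U and with its
  transpose, this passes between a feasible matrix and its coordinates in both directions.\<close>

lemma psd_sym_part_mats_congruence:
  assumes T: "T \<in> psd_sym_part_mats k" and W: "W \<in> carrier_mat n k"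
  shows "W * T * W\<^sup>T \<in> psd_sym_part_mats n"
proof -
  have Tc: "T \<in> carrier_mat k k" using T by (simp add: psd_sym_part_mats_iff)
  have "0 \<le> v \<bullet> (W * T * W\<^sup>T *\<^sub>v v)" if v: "v \<in> carrier_vec n" for v
  proof -
    have WT: "W\<^sup>T \<in> carrier_mat k n" using W by simp
    have u: "W\<^sup>T *\<^sub>v v \<in> carrier_vec k" using WT v by (rule mult_mat_vec_carrier)
    have "W * T * W\<^sup>T *\<^sub>v v = W *\<^sub>v (T *\<^sub>v (W\<^sup>T *\<^sub>v v))"
      using Tc W WT v u by (simp add: assoc_mult_mat_vec[of "W * T" n k "W\<^sup>T" n]
        assoc_mult_mat_vec[of W n k T k] del: assoc_mult_mat)
    then have "v \<bullet> (W * T * W\<^sup>T *\<^sub>v v) = (W\<^sup>T *\<^sub>v v) \<bullet> (T *\<^sub>v (W\<^sup>T *\<^sub>v v))"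
      using transpose_vec_mult_scalar[OF W mult_mat_vec_carrier[OF Tc u] v] by simp
    then show ?thesis using T u by (simp add: psd_sym_part_mats_iff)
  qed
  moreover have "W * T * W\<^sup>T \<in> carrier_mat n n"
    using Tc W by (intro mult_carrier_mat[of _ n k]) auto
  ultimately show ?thesis by (simp add: psd_sym_part_mats_iff del: assoc_mult_mat)
qed

text \<open>With C = Z and B = M^T the coupling matrix is Z + M, so this equivalence produces the
  kernel and Schur conditions on the parameters.\<close>

lemma psd_sym_part_mats_four_block_schur:
  assumes c: "A \<in> carrier_mat p p" "B \<in> carrier_mat p q" "C \<in> carrier_mat q p" "D \<in> carrier_mat q q"
  shows "four_block_mat A B C D \<in> psd_sym_part_mats (p + q) \<longleftrightarrow>
    A \<in> psd_sym_part_mats p \<and> mat_kernel (sym_part A) \<subseteq> mat_kernel (C + B\<^sup>T) \<and>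
    (\<forall>w \<in> carrier_vec q.
      0 \<le> w \<bullet> ((D - (1/4) \<cdot>\<^sub>m ((C + B\<^sup>T) * pinv (sym_part A) * (C + B\<^sup>T)\<^sup>T)) *\<^sub>v w))"
proof -
  have K: "C + B\<^sup>T \<in> carrier_mat q p" using c by simp
  have "(\<forall>v \<in> carrier_vec p. 0 \<le> v \<bullet> (sym_part A *\<^sub>v v)) \<longleftrightarrow> A \<in> psd_sym_part_mats p"
    using c(1) by (simp add: psd_sym_part_mats_iff quadratic_form_sym_part)
  then show ?thesis
    unfolding psd_sym_part_mats_four_block_iff[OF c]
      schur_complement_iff[OF sym_part_carrier[OF c(1)] sym_part_symmetric[OF c(1)] K c(4)]
    by simp
qed

text \<open>The diagonal matrix of reciprocals shows that \<open>S\<close> is a unit, so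
  \<open>mat_inverse S\<close> is not \<open>None\<close> and \<open>the\<close> returns a genuine
  inverse.\<close>

lemma mat_inverse_diagonal:
  assumes S: "(S :: real mat) \<in> carrier_mat r r" "diagonal_mat S" "\<forall>i<r. S $$ (i,i) > 0"
  shows "the (mat_inverse S) \<in> carrier_mat r r" "S * the (mat_inverse S) = 1\<^sub>m r"
    "the (mat_inverse S) * S = 1\<^sub>m r"
proof -
  define W where "W = mat r r (\<lambda>(i,j). if i = j then 1 / S $$ (i,i) else 0)"
  have W: "W \<in> carrier_mat r r" "diagonal_mat W" by (auto simp: W_def diagonal_mat_def)
  have "S * W = 1\<^sub>m r"
  proof (rule eq_matI)
    fix i j assume "i < dim_row (1\<^sub>m r :: real mat)" "j < dim_col (1\<^sub>m r :: real mat)"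
    then have ij: "i < r" "j < r" by auto
    have "(S * W) $$ (i,j) = S $$ (i,j) * W $$ (j,j)" by (rule index_mult_diagonal[OF S(1) W ij])
    then show "(S * W) $$ (i,j) = 1\<^sub>m r $$ (i,j)"
      using S ij by (auto simp: W_def diagonal_mat_def less_imp_neq[symmetric] simp del: index_mult_mat(1))
  qed (use S W in auto)
  moreover have "W * S = 1\<^sub>m r"
  proof (rule eq_matI)
    fix i j assume "i < dim_row (1\<^sub>m r :: real mat)" "j < dim_col (1\<^sub>m r :: real mat)"
    then have ij: "i < r" "j < r" by auto
    have "(W * S) $$ (i,j) = W $$ (i,j) * S $$ (j,j)" by (rule index_mult_diagonal[OF W(1) S(1,2) ij])
    then show "(W * S) $$ (i,j) = 1\<^sub>m r $$ (i,j)"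
      using S ij by (auto simp: W_def diagonal_mat_def less_imp_neq[symmetric] simp del: index_mult_mat(1))
  qed (use S W in auto)
  ultimately have "S \<in> Units (ring_mat TYPE(real) r ())"
    using S W by (auto simp: Units_def ring_mat_def)
  with mat_inverse(1)[OF S(1), of "()"] obtain W' where "mat_inverse S = Some W'"
    by (cases "mat_inverse S") auto
  with mat_inverse(2)[OF S(1) this]
  show "the (mat_inverse S) \<in> carrier_mat r r" "S * the (mat_inverse S) = 1\<^sub>m r"
    "the (mat_inverse S) * S = 1\<^sub>m r" by auto
qed

subsection \<open>The residual in singular value coordinates\<close>

text \<open>Orthogonal invariance reduces the residual to T Sigma - U^T B V. The second block column
  of T Sigma is zero, so \<open>A12\<close> and \<open>A22\<close> drop out, and that column
  contributes the norm of U^T B V2, which is the norm of B V2.\<close>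

lemma svd_residual:
  fixes U1 U2 V1 V2 S1 B :: "real mat"
  assumes U1: "U1 \<in> carrier_mat n p" and U2: "U2 \<in> carrier_mat n q"
    and V1: "V1 \<in> carrier_mat m p" and V2: "V2 \<in> carrier_mat m s"
    and S1: "S1 \<in> carrier_mat p p" and B: "B \<in> carrier_mat n m"
    and U: "U = append_cols U1 U2" "orthonormal_mat n U"
    and V: "V = append_cols V1 V2" "orthonormal_mat m V"
    and X: "X = U * four_block_mat S1 (0\<^sub>m p s) (0\<^sub>m q p) (0\<^sub>m q s) * V\<^sup>T"
    and c: "A11 \<in> carrier_mat p p" "A12 \<in> carrier_mat p q" "A21 \<in> carrier_mat q p" "A22 \<in> carrier_mat q q"
    and nm: "p + q = n" "p + s = m"
  shows "(frob_norm (U * four_block_mat A11 A12 A21 A22 * U\<^sup>T * X - B))\<^sup>2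
    = (frob_norm (A11 * S1 - U1\<^sup>T * B * V1))\<^sup>2 + (frob_norm (A21 * S1 - U2\<^sup>T * B * V1))\<^sup>2
      + (frob_norm (B * V2))\<^sup>2"
proof -
  define T where "T = four_block_mat A11 A12 A21 A22"
  define \<Sigma> where "\<Sigma> = four_block_mat S1 (0\<^sub>m p s) (0\<^sub>m q p) (0\<^sub>m q s)"
  define W where "W = U\<^sup>T * B * V"
  have Uc: "U \<in> carrier_mat n n" "U\<^sup>T \<in> carrier_mat n n" and Vc: "V \<in> carrier_mat m m" "V\<^sup>T \<in> carrier_mat m m"
    and Uo: "U\<^sup>T * U = 1\<^sub>m n" "U * U\<^sup>T = 1\<^sub>m n" and Vo: "V\<^sup>T * V = 1\<^sub>m m" "V * V\<^sup>T = 1\<^sub>m m"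
    using U(2) V(2) by (auto simp: orthonormal_mat_def)
  have T: "T \<in> carrier_mat n n"
    unfolding T_def nm[symmetric] using c by (intro four_block_carrier_mat) auto
  have \<Sigma>: "\<Sigma> \<in> carrier_mat n m"
    unfolding \<Sigma>_def nm[symmetric] using S1 by (intro four_block_carrier_mat) auto
  have W: "W \<in> carrier_mat n m"
    unfolding W_def using Uc Vc B by (intro mult_carrier_mat[of _ n m] mult_carrier_mat[of _ n n])
  have T\<Sigma>: "T * \<Sigma> \<in> carrier_mat n m" using T \<Sigma> by (rule mult_carrier_mat)
  have "U * T * U\<^sup>T * X = U * (T * ((U\<^sup>T * U) * (\<Sigma> * V\<^sup>T)))"
    unfolding X \<Sigma>_def[symmetric] using T \<Sigma> Uc Vc
    by (simp add: assoc_mult_mat[of _ n n _ n _ m] assoc_mult_mat[of _ n n _ n _ n]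
      assoc_mult_mat[of _ n n _ m _ m] mult_carrier_mat[of _ n m _ m] mult_carrier_mat[of _ n n _ m]
      del: assoc_mult_mat)
  also have "\<dots> = U * (T * \<Sigma>) * V\<^sup>T"
    using T \<Sigma> Uc Vc T\<Sigma> unfolding Uo
    by (simp add: assoc_mult_mat[of U n n "T * \<Sigma>" m "V\<^sup>T" m] assoc_mult_mat[of T n n \<Sigma> m "V\<^sup>T" m]
      mult_carrier_mat[of \<Sigma> n m _ m] left_mult_one_mat[of _ n m] del: assoc_mult_mat)
  finally have 1: "U * T * U\<^sup>T * X = U * (T * \<Sigma>) * V\<^sup>T" .
  have UB: "U\<^sup>T * B \<in> carrier_mat n m" using Uc B by simp
  \<comment> \<open>\<open>B\<close> is written in the same coordinates, so that U and V^T factor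
    out of the difference.\<close>
  have "U * W * V\<^sup>T = U * (W * V\<^sup>T)"
    by (rule assoc_mult_mat[OF Uc(1) W Vc(2)])
  also have "W * V\<^sup>T = U\<^sup>T * B"
    unfolding W_def assoc_mult_mat[OF UB Vc] Vo by (rule right_mult_one_mat[OF UB])
  also have "U * (U\<^sup>T * B) = B"
    unfolding assoc_mult_mat[OF Uc B, symmetric] using B by (simp add: Uo)
  finally have 2: "U * W * V\<^sup>T = B" .
  have D: "T * \<Sigma> - W \<in> carrier_mat n m" using W by (rule minus_carrier_mat)
  have "U * T * U\<^sup>T * X - B = U * (T * \<Sigma> - W) * V\<^sup>T"
    unfolding 1 mult_minus_distrib_mat[OF Uc(1) T\<Sigma> W]
      minus_mult_distrib_mat[OF mult_carrier_mat[OF Uc(1) T\<Sigma>] mult_carrier_mat[OF Uc(1) W] Vc(2)] 2 ..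
  then have "(frob_norm (U * T * U\<^sup>T * X - B))\<^sup>2 = (frob_norm (T * \<Sigma> - W))\<^sup>2"
    using frob_norm_sq_mult_transpose_isometry[OF Vc(1) Vo(1) mult_carrier_mat[OF Uc(1) D]]
      frob_norm_sq_isometry_mult[OF Uc(1) Uo(1) D] by simp
  also have "T * \<Sigma> = four_block_mat (A11 * S1) (0\<^sub>m p s) (A21 * S1) (0\<^sub>m q s)"
    unfolding T_def \<Sigma>_def using c S1
    by (subst mult_four_block_mat[of _ p p _ q _ q _ _ p _ s]) auto
  also have W4: "W = four_block_mat (U1\<^sup>T * B * V1) (U1\<^sup>T * B * V2) (U2\<^sup>T * B * V1) (U2\<^sup>T * B * V2)"
    unfolding W_def U(1) V(1) by (rule transpose_append_cols_mult_mult_append_cols[OF U1 U2 B V1 V2])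
  have Bc: "U1\<^sup>T * B * V1 \<in> carrier_mat p p" "U1\<^sup>T * B * V2 \<in> carrier_mat p s"
    "U2\<^sup>T * B * V1 \<in> carrier_mat q p" "U2\<^sup>T * B * V2 \<in> carrier_mat q s"
    using U1 U2 V1 V2 B by (auto intro!: mult_carrier_mat[of _ _ m] mult_carrier_mat[of _ _ n])
  have Ac: "A11 * S1 \<in> carrier_mat p p" "A21 * S1 \<in> carrier_mat q p" using c S1 by auto
  have "four_block_mat (A11 * S1) (0\<^sub>m p s) (A21 * S1) (0\<^sub>m q s) - W
      = four_block_mat (A11 * S1 - U1\<^sup>T * B * V1) (0\<^sub>m p s - U1\<^sup>T * B * V2)
        (A21 * S1 - U2\<^sup>T * B * V1) (0\<^sub>m q s - U2\<^sup>T * B * V2)"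
    unfolding W4 using Ac Bc by (intro minus_four_block_mat[of _ p p _ s _ q]) auto
  also have "(frob_norm \<dots>)\<^sup>2 = (frob_norm (A11 * S1 - U1\<^sup>T * B * V1))\<^sup>2 + (frob_norm (U1\<^sup>T * B * V2))\<^sup>2
      + (frob_norm (A21 * S1 - U2\<^sup>T * B * V1))\<^sup>2 + (frob_norm (U2\<^sup>T * B * V2))\<^sup>2"
    using Bc by (subst frob_norm_sq_four_block[of _ p p _ s _ q])
      (auto simp: frob_norm_sq_zero_minus simp del: assoc_mult_mat intro!: minus_carrier_mat)
  finally have 3: "(frob_norm (U * T * U\<^sup>T * X - B))\<^sup>2
      = (frob_norm (A11 * S1 - U1\<^sup>T * B * V1))\<^sup>2 + (frob_norm (U1\<^sup>T * B * V2))\<^sup>2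
        + (frob_norm (A21 * S1 - U2\<^sup>T * B * V1))\<^sup>2 + (frob_norm (U2\<^sup>T * B * V2))\<^sup>2" .
  have BV: "B * V2 \<in> carrier_mat n s" using B V2 by simp
  \<comment> \<open>The two remaining blocks are recombined: U^T is an isometry because U U^T = 1,
    and the right-hand blocks are empty.\<close>
  have "U\<^sup>T * (B * V2) = four_block_mat (U1\<^sup>T * (B * V2)) (U1\<^sup>T * 0\<^sub>m n 0) (U2\<^sup>T * (B * V2)) (U2\<^sup>T * 0\<^sub>m n 0)"
    unfolding U(1) using transpose_append_cols_mult_append_cols[OF U1 U2 BV zero_carrier_mat[of n 0]]
    by (simp add: append_cols_zero_cols[OF BV])
  also have "\<dots> = four_block_mat (U1\<^sup>T * B * V2) (0\<^sub>m p 0) (U2\<^sup>T * B * V2) (0\<^sub>m q 0)"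
    using U1 U2 B V2 by (simp add: assoc_mult_mat[of _ p n _ m] assoc_mult_mat[of _ q n _ m])
  finally have "(frob_norm (B * V2))\<^sup>2 = (frob_norm (U1\<^sup>T * B * V2))\<^sup>2 + (frob_norm (U2\<^sup>T * B * V2))\<^sup>2"
    using frob_norm_sq_isometry_mult[OF Uc(2) _ BV] Uo(2) Bc
    by (simp add: frob_norm_sq_four_block[of _ p s _ 0 _ q] frob_norm_sq[of "0\<^sub>m _ _"] del: assoc_mult_mat)
  with 3 show ?thesis by (simp add: T_def)
qed

section \<open>The semidefinite bound on the free block and the solution set\<close>

lemma quarter_conjugate_pinv_symmetric:
  assumes H: "H \<in> carrier_mat p p" "H\<^sup>T = H" and K: "K \<in> carrier_mat q p"
  shows "(1/4) \<cdot>\<^sub>m (K * pinv H * K\<^sup>T) \<in> carrier_mat q q"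
    "((1/4) \<cdot>\<^sub>m (K * pinv H * K\<^sup>T))\<^sup>T = (1/4) \<cdot>\<^sub>m (K * pinv H * K\<^sup>T)"
proof -
  note P = pinv_symmetric[OF H]
  have KP: "K * pinv H \<in> carrier_mat q p" using K P(1) by (rule mult_carrier_mat)
  have KT: "K\<^sup>T \<in> carrier_mat p q" using K by simp
  show "(1/4) \<cdot>\<^sub>m (K * pinv H * K\<^sup>T) \<in> carrier_mat q q"
    using mult_carrier_mat[OF KP KT] by simp
  have "(K * pinv H * K\<^sup>T)\<^sup>T = K * (pinv H * K\<^sup>T)"
    unfolding transpose_mult[OF KP KT] transpose_mult[OF K P(1)] by (simp add: P(2))
  also have "\<dots> = K * pinv H * K\<^sup>T" by (rule assoc_mult_mat[OF K P(1) KT, symmetric])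
  finally have "(K * pinv H * K\<^sup>T)\<^sup>T = K * pinv H * K\<^sup>T" .
  moreover have "((1/4) \<cdot>\<^sub>m M)\<^sup>T = (1/4) \<cdot>\<^sub>m M\<^sup>T" for M :: "real mat" by (intro eq_matI) auto
  ultimately show "((1/4) \<cdot>\<^sub>m (K * pinv H * K\<^sup>T))\<^sup>T = (1/4) \<cdot>\<^sub>m (K * pinv H * K\<^sup>T)" by simp
qed

text \<open>\<open>G\<close> is invisible to the quadratic form, and N - E is automatically
  symmetric as \<open>psd_mat\<close> demands. The Schur condition on the block N + G thus becomes
  an order relation for \<open>N\<close> alone.\<close>

lemma psd_ge_iff_add_skew:
  assumes N: "N \<in> carrier_mat q q" "N\<^sup>T = N" and G: "G \<in> carrier_mat q q" "G\<^sup>T = - G"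
    and E: "E \<in> carrier_mat q q" "E\<^sup>T = E"
  shows "psd_ge q N E \<longleftrightarrow> (\<forall>w \<in> carrier_vec q. 0 \<le> w \<bullet> ((N + G - E) *\<^sub>v w))"
proof -
  have NE: "N - E \<in> carrier_mat q q" using E(1) by (rule minus_carrier_mat)
  have "(N - E)\<^sup>T = N - E" using N E by (simp add: transpose_minus[of _ q q])
  moreover have "N + G - E = (N - E) + G" using N G E by (intro eq_matI) auto
  ultimately show ?thesis
    using NE by (simp add: psd_ge_def psd_mat_def quadratic_form_add_skew[OF NE G])
qed

text \<open>\<open>ARG_MIN\<close> is a choice operator, informative only once a minimizer exists.
  The first two conjuncts supply this and uniqueness, so the right-hand side of the infimum formula
  really contains the reduced minimum. The cases r = 0, r = n and r = m are covered through empty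
  blocks.\<close>

theorem theorem3p1:
  fixes n m r :: nat
    and X B U V U1 U2 V1 V2 S1 Ahat Hhat Shat Z :: "real mat"
  assumes X: "X \<in> carrier_mat n m"
    and B: "B \<in> carrier_mat n m"
    and r: "r \<le> n" "r \<le> m"
    and U1: "U1 \<in> carrier_mat n r" and U2: "U2 \<in> carrier_mat n (n - r)"
    and V1: "V1 \<in> carrier_mat m r" and V2: "V2 \<in> carrier_mat m (m - r)"
    and U: "U = append_cols U1 U2" "orthonormal_mat n U"
    and V: "V = append_cols V1 V2" "orthonormal_mat m V"
    and S1: "S1 \<in> carrier_mat r r" "diagonal_mat S1" "\<forall>i<r. S1 $$ (i,i) > 0"
    and svd: "X = U * four_block_mat S1 (0\<^sub>m r (m - r)) (0\<^sub>m (n - r) r) (0\<^sub>m (n - r) (m - r)) * V\<^sup>T"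
    and Ahat: "Ahat = (ARG_MIN (\<lambda>A11. (frob_norm (A11 * S1 - U1\<^sup>T * B * V1))\<^sup>2) A11. A11 \<in> psd_sym_part_mats r)"
    and Hhat: "Hhat = sym_part Ahat"
    and Shat: "Shat = skew_part Ahat"
    and Z: "Z = U2\<^sup>T * B * V1 * the (mat_inverse S1)"
  shows
    "let params = (\<lambda>M N G.
           M \<in> carrier_mat (n - r) r \<and>
           G \<in> carrier_mat (n - r) (n - r) \<and> G\<^sup>T = - G \<and>
           N \<in> carrier_mat (n - r) (n - r) \<and> N\<^sup>T = N \<and>
           mat_kernel Hhat \<subseteq> mat_kernel (Z + M) \<and>
           psd_ge (n - r) N ((1/4) \<cdot>\<^sub>m ((Z + M) * pinv Hhat * (Z + M)\<^sup>T)));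
         Astar = (\<lambda>M N G. U * four_block_mat Ahat (M\<^sup>T) Z (N + G) * U\<^sup>T)
     in
       is_arg_min (\<lambda>A11. (frob_norm (A11 * S1 - U1\<^sup>T * B * V1))\<^sup>2) (\<lambda>A11. A11 \<in> psd_sym_part_mats r) Ahat \<and>
       (\<forall>A11. is_arg_min (\<lambda>A11. (frob_norm (A11 * S1 - U1\<^sup>T * B * V1))\<^sup>2) (\<lambda>A11. A11 \<in> psd_sym_part_mats r) A11
          \<longrightarrow> A11 = Ahat) \<and>
       Ahat = Hhat + Shat \<and>
       (INF A \<in> psd_sym_part_mats n. (frob_norm (A * X - B))\<^sup>2)
         = (frob_norm (Ahat * S1 - U1\<^sup>T * B * V1))\<^sup>2 + (frob_norm (B * V2))\<^sup>2 \<and>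
       (\<forall>A. is_arg_min (\<lambda>A. (frob_norm (A * X - B))\<^sup>2) (\<lambda>A. A \<in> psd_sym_part_mats n) A \<longrightarrow>
          (\<exists>M N G. params M N G \<and> A = Astar M N G)) \<and>
       (\<forall>M N G. params M N G \<longrightarrow>
          Astar M N G = U1 * Ahat * U1\<^sup>T + U2 * Z * U1\<^sup>T + U1 * M\<^sup>T * U2\<^sup>T + U2 * (N + G) * U2\<^sup>T \<and>
          Astar M N G \<in> psd_sym_part_mats n)"
proof -
  define q where "q = n - r"
  define s where "s = m - r"
  have nm: "r + q = n" "r + s = m" using r by (auto simp: q_def s_def)
  note dims = q_def[symmetric] s_def[symmetric]
  note U2 = U2[unfolded dims] and V2 = V2[unfolded dims] and svd = svd[unfolded dims]
  have Uc: "U \<in> carrier_mat n n" and Uo: "U\<^sup>T * U = 1\<^sub>m n" "U * U\<^sup>T = 1\<^sub>m n"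
    using U(2) by (auto simp: orthonormal_mat_def)
  have UTc: "U\<^sup>T \<in> carrier_mat n n" using Uc by simp
  define C where "C = U1\<^sup>T * B * V1"
  define D where "D = U2\<^sup>T * B * V1"
  define f1 where "f1 = (\<lambda>A11. (frob_norm (A11 * S1 - C))\<^sup>2)"
  define f where "f = (\<lambda>A. (frob_norm (A * X - B))\<^sup>2)"
  define P where "P = psd_sym_part_mats n"
  define E where "E = (\<lambda>M. (1/4) \<cdot>\<^sub>m ((Z + M) * pinv Hhat * (Z + M)\<^sup>T))"
  define params where "params = (\<lambda>M N (G :: real mat). M \<in> carrier_mat q r \<and> G \<in> carrier_mat q q \<and> G\<^sup>T = - G \<and>
    N \<in> carrier_mat q q \<and> N\<^sup>T = N \<and> mat_kernel Hhat \<subseteq> mat_kernel (Z + M) \<and> psd_ge q N (E M))"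
  define Tstar where "Tstar = (\<lambda>M N G. four_block_mat Ahat (M\<^sup>T) Z (N + G))"
  define Astar where "Astar = (\<lambda>M N G. U * Tstar M N G * U\<^sup>T)"
  have Cc: "C \<in> carrier_mat r r" and Dc: "D \<in> carrier_mat q r"
    using U1 U2 V1 B by (auto simp: C_def D_def intro!: mult_carrier_mat[of _ _ m] mult_carrier_mat[of _ _ n])
  note Si = mat_inverse_diagonal[OF S1]
  have Zc: "Z \<in> carrier_mat q r" and ZS: "Z * S1 = D"
    unfolding Z D_def[symmetric] using Dc Si S1(1) by (auto simp: assoc_mult_mat[of _ q r _ r _ r])
  have min: "is_arg_min f1 (\<lambda>A. A \<in> psd_sym_part_mats r) Ahat"
    using someI_ex[OF diagonal_residual_minimizer_exists[OF S1 Cc]]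
    by (simp add: Ahat arg_min_def f1_def C_def)
  have uniq: "A = Ahat" if "is_arg_min f1 (\<lambda>A. A \<in> psd_sym_part_mats r) A" for A
    using diagonal_residual_minimizer_unique[OF S1 Cc] that min unfolding f1_def by blast
  have Ahat_psd: "Ahat \<in> psd_sym_part_mats r" using min by (simp add: is_arg_min_def)
  have Ac: "Ahat \<in> carrier_mat r r" using Ahat_psd by (simp add: psd_sym_part_mats_iff)
  have Hc: "Hhat \<in> carrier_mat r r" "Hhat\<^sup>T = Hhat"
    unfolding Hhat using Ac by (auto intro: sym_part_carrier sym_part_symmetric)
  have Ec: "E M \<in> carrier_mat q q" "(E M)\<^sup>T = E M" if "M \<in> carrier_mat q r" for M
    unfolding E_def using quarter_conjugate_pinv_symmetric[OF Hc, of "Z + M" q] Zc that by auto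
  have residual: "f (U * four_block_mat A11 A12 A21 A22 * U\<^sup>T)
      = f1 A11 + (frob_norm (A21 * S1 - D))\<^sup>2 + (frob_norm (B * V2))\<^sup>2"
    if "A11 \<in> carrier_mat r r" "A12 \<in> carrier_mat r q" "A21 \<in> carrier_mat q r" "A22 \<in> carrier_mat q q"
    for A11 A12 A21 A22
    unfolding f_def f1_def C_def D_def
    by (rule svd_residual[OF U1 U2 V1 V2 S1(1) B U V svd that nm])
  have blocks: "\<exists>A11 A12 A21 A22. A11 \<in> psd_sym_part_mats r \<and> A11 \<in> carrier_mat r r \<and>
      A12 \<in> carrier_mat r q \<and> A21 \<in> carrier_mat q r \<and> A22 \<in> carrier_mat q q \<and>
      four_block_mat A11 A12 A21 A22 \<in> psd_sym_part_mats n \<and>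
      A = U * four_block_mat A11 A12 A21 A22 * U\<^sup>T" if A: "A \<in> P" for A
  proof -
    have Am: "A \<in> carrier_mat n n" using A by (simp add: P_def psd_sym_part_mats_iff)
    define T where "T = U\<^sup>T * A * U"
    have Tpsd: "T \<in> psd_sym_part_mats n"
      using psd_sym_part_mats_congruence[OF A[unfolded P_def] UTc] by (simp add: T_def)
    then have Tc: "T \<in> carrier_mat n n" by (simp add: psd_sym_part_mats_iff)
    have "U * T * U\<^sup>T = (U * U\<^sup>T) * A * (U * U\<^sup>T)"
      unfolding T_def using Uc UTc Am by (simp add: assoc_mult_mat[of _ n n _ n _ n]
        mult_carrier_mat[of _ n n _ n] del: assoc_mult_mat)
    then have AT: "A = U * T * U\<^sup>T" using Am by (simp add: Uo)
    obtain A11 A12 A21 A22 where sp: "split_block T r r = (A11, A12, A21, A22)"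
      by (metis prod_cases4)
    have b: "A11 \<in> carrier_mat r r" "A12 \<in> carrier_mat r q" "A21 \<in> carrier_mat q r"
      "A22 \<in> carrier_mat q q" "T = four_block_mat A11 A12 A21 A22"
      using split_block[OF sp, of q q] Tc nm by auto
    \<comment> \<open>The leading block inherits feasibility, one component of the Schur
      equivalence.\<close>
    have "A11 \<in> psd_sym_part_mats r"
      using psd_sym_part_mats_four_block_schur[OF b(1-4)] Tpsd by (simp add: b(5) nm)
    with b AT Tpsd show ?thesis by blast
  qed
  have lower: "f1 Ahat + (frob_norm (B * V2))\<^sup>2 \<le> f A" if AP: "A \<in> P" for A
  proof -
    obtain A11 A12 A21 A22 where b: "A11 \<in> psd_sym_part_mats r" "A11 \<in> carrier_mat r r"
      "A12 \<in> carrier_mat r q" "A21 \<in> carrier_mat q r" "A22 \<in> carrier_mat q q"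
      "A = U * four_block_mat A11 A12 A21 A22 * U\<^sup>T" using blocks[OF AP] by blast
    have "f1 Ahat \<le> f1 A11" using min b(1) by (simp add: is_arg_min_linorder)
    then show ?thesis
      unfolding b(6) residual[OF b(2-5)] using zero_le_power2[of "frob_norm (A21 * S1 - D)"] by linarith
  qed
  have schur: "Tstar M N G \<in> psd_sym_part_mats n \<longleftrightarrow>
      mat_kernel Hhat \<subseteq> mat_kernel (Z + M) \<and> psd_ge q N (E M)"
    if c: "M \<in> carrier_mat q r" "N \<in> carrier_mat q q" "N\<^sup>T = N" "G \<in> carrier_mat q q" "G\<^sup>T = - G" for M N G
    using psd_sym_part_mats_four_block_schur[OF Ac _ Zc, of "M\<^sup>T" "N + G"] c Ahat_psd
    unfolding Tstar_def psd_ge_iff_add_skew[OF c(2-5) Ec[OF c(1)]] by (simp add: nm Hhat E_def)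
  have Tstar_psd: "Tstar M N G \<in> psd_sym_part_mats n" if "params M N G" for M N G
    using that schur by (simp add: params_def)
  have Astar_psd: "Astar M N G \<in> P" if "params M N G" for M N G
    unfolding Astar_def P_def using Tstar_psd[OF that] Uc by (rule psd_sym_part_mats_congruence)
  have f_Astar: "f (Astar M N G) = f1 Ahat + (frob_norm (B * V2))\<^sup>2" if "params M N G" for M N G
  proof -
    have "(frob_norm (Z * S1 - D))\<^sup>2 = 0" unfolding ZS using Dc by (simp add: frob_norm_sq)
    then show ?thesis
      unfolding Astar_def Tstar_def using that Ac Zc by (subst residual) (auto simp: params_def)
  qed
  \<comment> \<open>M = -Z cancels the coupling Z + M. The kernel condition becomes trivial and the
    lower bound for \<open>N\<close> becomes zero, so N = G = 0 is admissible and the bound is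
    attained.\<close>
  have attained: "params (- Z) (0\<^sub>m q q) (0\<^sub>m q q)"
  proof -
    have ZZ: "Z + - Z = 0\<^sub>m q r" using Zc by (intro eq_matI) auto
    have "E (- Z) = 0\<^sub>m q q"
      unfolding E_def ZZ using pinv_symmetric(1)[OF Hc] by (intro eq_matI) auto
    moreover have "mat_kernel Hhat \<subseteq> mat_kernel (0\<^sub>m q r)"
    proof
      fix v assume "v \<in> mat_kernel Hhat"
      then have "v \<in> carrier_vec r" using mat_kernelD(1)[OF Hc(1)] by blast
      then show "v \<in> mat_kernel (0\<^sub>m q r)" by (intro mat_kernelI[of _ q r]) (auto intro!: eq_vecI)
    qed
    moreover have "psd_ge q (0\<^sub>m q q) (0\<^sub>m q q)"
      by (auto simp: psd_ge_def psd_mat_def quadratic_form_sum[of _ q] minus_r_inv_mat[of _ q q])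
    ultimately show ?thesis using Zc by (auto simp: params_def ZZ)
  qed
  have inf: "(INF A \<in> P. f A) = f1 Ahat + (frob_norm (B * V2))\<^sup>2"
  proof (rule cInf_eq_minimum)
    show "f1 Ahat + (frob_norm (B * V2))\<^sup>2 \<in> f ` P"
      using f_Astar[OF attained] Astar_psd[OF attained] by (metis imageI)
  qed (auto intro: lower)
  have solutions: "\<exists>M N G. params M N G \<and> A = Astar M N G" if A: "is_arg_min f (\<lambda>A. A \<in> P) A" for A
  proof -
    have AP: "A \<in> P" using A by (simp add: is_arg_min_def)
    obtain A11 A12 A21 A22 where b: "A11 \<in> psd_sym_part_mats r" "A11 \<in> carrier_mat r r"
      "A12 \<in> carrier_mat r q" "A21 \<in> carrier_mat q r" "A22 \<in> carrier_mat q q"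
      and Tpsd: "four_block_mat A11 A12 A21 A22 \<in> psd_sym_part_mats n"
      and AT: "A = U * four_block_mat A11 A12 A21 A22 * U\<^sup>T" using blocks[OF AP] by blast
    have "f A \<le> f1 Ahat + (frob_norm (B * V2))\<^sup>2"
      using A Astar_psd[OF attained] f_Astar[OF attained] by (metis is_arg_min_linorder)
    \<comment> \<open>Since \<open>f1 Ahat\<close> is the least feasible value of \<open>f1\<close>,
      this inequality forces \<open>A11\<close> to be a minimizer and the square involving
      \<open>A21\<close> to vanish.\<close>
    then have le: "f1 A11 + (frob_norm (A21 * S1 - D))\<^sup>2 \<le> f1 Ahat"
      unfolding AT residual[OF b(2-5)] by simp
    have ge: "f1 Ahat \<le> f1 A'" if "A' \<in> psd_sym_part_mats r" for A'
      using min that by (simp add: is_arg_min_linorder)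
    have "f1 A11 \<le> f1 Ahat" using le zero_le_power2[of "frob_norm (A21 * S1 - D)"] by linarith
    then have "is_arg_min f1 (\<lambda>A. A \<in> psd_sym_part_mats r) A11"
      unfolding is_arg_min_linorder using b(1) ge by (meson order_trans)
    then have A11: "A11 = Ahat" by (rule uniq)
    have "(frob_norm (A21 * S1 - D))\<^sup>2 = 0" using le by (simp add: A11)
    then have "A21 * S1 - D = 0\<^sub>m q r"
      using frob_norm_sq_eq_0_iff[of "A21 * S1 - D" q r] Dc by (simp add: minus_carrier_mat)
    then have "D = A21 * S1"
      by (rule eq_if_minus_mat_eq_zero[OF mult_carrier_mat[OF b(4) S1(1)] Dc, symmetric])
    then have "Z = A21 * (S1 * the (mat_inverse S1))"
      unfolding Z D_def[symmetric] using b(4) S1(1) Si(1) by (simp add: assoc_mult_mat[of _ q r _ r _ r])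
    then have A21: "A21 = Z" using b(4) by (simp add: Si(2))
    \<comment> \<open>The residual leaves \<open>A12\<close> and \<open>A22\<close> free. They are
      renamed as parameters, with \<open>A22\<close> split into symmetric and skew parts;
      feasibility of \<open>A\<close> then yields the remaining conditions through
      \<open>schur\<close>.\<close>
    define M where "M = A12\<^sup>T"
    define N where "N = sym_part A22"
    define G where "G = skew_part A22"
    have c: "M \<in> carrier_mat q r" "N \<in> carrier_mat q q" "N\<^sup>T = N" "G \<in> carrier_mat q q" "G\<^sup>T = - G"
      using b(3,5) by (auto simp: M_def N_def G_def sym_part_carrier sym_part_symmetric
        skew_part_carrier skew_part_skew)
    have T: "four_block_mat A11 A12 A21 A22 = Tstar M N G"
      unfolding Tstar_def A11 A21 N_def G_def M_def sym_part_add_skew_part[OF b(5)] by simp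
    have "params M N G" using Tpsd schur[OF c] c unfolding T params_def by blast
    moreover have "A = Astar M N G" unfolding AT T Astar_def ..
    ultimately show ?thesis by blast
  qed
  have expand: "Astar M N G = U1 * Ahat * U1\<^sup>T + U2 * Z * U1\<^sup>T + U1 * M\<^sup>T * U2\<^sup>T + U2 * (N + G) * U2\<^sup>T"
    if "params M N G" for M N G
    unfolding Astar_def Tstar_def U(1)
    using that U1 U2 Ac Zc by (intro conjugate_append_cols) (auto simp: params_def)
  have sum: "Ahat = Hhat + Shat" unfolding Hhat Shat using sym_part_add_skew_part[OF Ac] by simp
  have "is_arg_min f1 (\<lambda>A11. A11 \<in> psd_sym_part_mats r) Ahat \<and>
      (\<forall>A11. is_arg_min f1 (\<lambda>A11. A11 \<in> psd_sym_part_mats r) A11 \<longrightarrow> A11 = Ahat) \<and>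
      Ahat = Hhat + Shat \<and>
      (INF A \<in> P. f A) = f1 Ahat + (frob_norm (B * V2))\<^sup>2 \<and>
      (\<forall>A. is_arg_min f (\<lambda>A. A \<in> P) A \<longrightarrow> (\<exists>M N G. params M N G \<and> A = Astar M N G)) \<and>
      (\<forall>M N G. params M N G \<longrightarrow>
        Astar M N G = U1 * Ahat * U1\<^sup>T + U2 * Z * U1\<^sup>T + U1 * M\<^sup>T * U2\<^sup>T + U2 * (N + G) * U2\<^sup>T \<and>
        Astar M N G \<in> P)"
    by (intro conjI allI impI min uniq sum inf solutions expand Astar_psd)
  then show ?thesis
    unfolding params_def Astar_def Tstar_def f1_def f_def C_def P_def E_def Let_def dims .
qed

end
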